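(* Let $q$ be an odd prime power. Let $C, D \subset \mathbb{P}^2$ be two distinct irreducible (equivalently, smooth) conics defined over $\mathbb{F}_q$. The number of points $P \in \mathbb{P}^2(\mathbb{F}_q)$ that are external to $C$ and internal to $D$ is $\frac{q^2}{4} + O(q^{3/2})$, where the implied constant is absolute (independent of $q$, $C$ and $D$).
   Context: Here "irreducible" for a conic means geometrically irreducible (irreducible over $\overline{\mathbb{F}_q}$), which for $q$ odd is equivalent to smoothness, i.e. to non-degeneracy of the defining ternary quadratic form. Conics are considered as curves (schemes), so $C \neq D$ means that their defining quadratic forms are not proportional. For a smooth conic $C \subset \mathbb{P}^2$ defined over $\mathbb{F}_q$ with $q$ odd and a point $P \in \mathbb{P}^2(\mathbb{F}_q)$ with $P \notin C$, either exactly two or none of the lines through $P$ defined over $\mathbb{F}_q$ are tangent to $C$. The point $P$ is called external to $C$ if $P \notin C$ and there are two tangent lines to $C$ defined over $\mathbb{F}_q$ passing through $P$; it is called internal to $C$ if $P \notin C$ and no tangent line to $C$ defined over $\mathbb{F}_q$ passes through $P$. *)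

theory Defs
  imports Complex_Main "HOL-Algebra.Algebraic_Closure"
begin

text \<open>
  Finite fields are HOL-Algebra fields \<open>F :: 'a ring\<close> with finite carrier rather than types of a
  type class: a constant that is uniform over all finite fields can then be quantified
  before the field. Every finite field has an isomorphic copy with carrier inside any given infinite
  type, so already the instance \<open>'a = nat\<close> of a statement of the form
  \<open>\<exists>K. \<forall>F :: 'a ring. ...\<close> is uniform over all finite fields.
\<close>


section \<open>Ternary quadratic forms\<close>

text \<open>\<open>QForm a b c d e f\<close> is a X^2 + b Y^2 + c Z^2 + d Y Z + e X Z + f X Y. The map function of the
  datatype is used for base change and for scaling, its set function for the set of coefficients.\<close>

datatype 'a qform = QForm 'a 'a 'a 'a 'a 'a

definition qforms :: "'a ring \<Rightarrow> 'a qform set" where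
  "qforms R = {Q. set_qform Q \<subseteq> carrier R}"

fun qeval :: "'a ring \<Rightarrow> 'a qform \<Rightarrow> 'a \<times> 'a \<times> 'a \<Rightarrow> 'a" where
  "qeval R (QForm a b c d e f) (x, y, z) =
     a \<otimes>\<^bsub>R\<^esub> (x \<otimes>\<^bsub>R\<^esub> x) \<oplus>\<^bsub>R\<^esub> b \<otimes>\<^bsub>R\<^esub> (y \<otimes>\<^bsub>R\<^esub> y) \<oplus>\<^bsub>R\<^esub> c \<otimes>\<^bsub>R\<^esub> (z \<otimes>\<^bsub>R\<^esub> z)
     \<oplus>\<^bsub>R\<^esub> d \<otimes>\<^bsub>R\<^esub> (y \<otimes>\<^bsub>R\<^esub> z) \<oplus>\<^bsub>R\<^esub> e \<otimes>\<^bsub>R\<^esub> (x \<otimes>\<^bsub>R\<^esub> z) \<oplus>\<^bsub>R\<^esub> f \<otimes>\<^bsub>R\<^esub> (x \<otimes>\<^bsub>R\<^esub> y)"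

text \<open>The vector of formal partial derivatives; 2 a x is written as a x + a x.\<close>

fun qgrad :: "'a ring \<Rightarrow> 'a qform \<Rightarrow> 'a \<times> 'a \<times> 'a \<Rightarrow> 'a \<times> 'a \<times> 'a" where
  "qgrad R (QForm a b c d e f) (x, y, z) =
     ((a \<otimes>\<^bsub>R\<^esub> x \<oplus>\<^bsub>R\<^esub> a \<otimes>\<^bsub>R\<^esub> x) \<oplus>\<^bsub>R\<^esub> e \<otimes>\<^bsub>R\<^esub> z \<oplus>\<^bsub>R\<^esub> f \<otimes>\<^bsub>R\<^esub> y,
      (b \<otimes>\<^bsub>R\<^esub> y \<oplus>\<^bsub>R\<^esub> b \<otimes>\<^bsub>R\<^esub> y) \<oplus>\<^bsub>R\<^esub> d \<otimes>\<^bsub>R\<^esub> z \<oplus>\<^bsub>R\<^esub> f \<otimes>\<^bsub>R\<^esub> x,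
      (c \<otimes>\<^bsub>R\<^esub> z \<oplus>\<^bsub>R\<^esub> c \<otimes>\<^bsub>R\<^esub> z) \<oplus>\<^bsub>R\<^esub> d \<otimes>\<^bsub>R\<^esub> y \<oplus>\<^bsub>R\<^esub> e \<otimes>\<^bsub>R\<^esub> x)"

definition proportional :: "'a ring \<Rightarrow> 'a qform \<Rightarrow> 'a qform \<Rightarrow> bool" where
  "proportional R Q Q' \<longleftrightarrow> (\<exists>k \<in> carrier R - {\<zero>\<^bsub>R\<^esub>}. Q' = map_qform (\<lambda>a. k \<otimes>\<^bsub>R\<^esub> a) Q)"


section \<open>Geometric irreducibility\<close>

text \<open>R[X,Y,Z] is realised as R[X][Y][Z].\<close>

abbreviation poly_ring2 :: "'a ring \<Rightarrow> 'a list list ring" where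
  "poly_ring2 R \<equiv> poly_ring (poly_ring R)"

abbreviation poly_ring3 :: "'a ring \<Rightarrow> 'a list list list ring" where
  "poly_ring3 R \<equiv> poly_ring (poly_ring2 R)"

definition const3 :: "'a ring \<Rightarrow> 'a \<Rightarrow> 'a list list list" where
  "const3 R a = ring.poly_of_const (poly_ring2 R)
     (ring.poly_of_const (poly_ring R) (ring.poly_of_const R a))"

definition vars3 :: "'a ring \<Rightarrow> 'a list list list \<times> 'a list list list \<times> 'a list list list" where
  "vars3 R =
     (ring.poly_of_const (poly_ring2 R) (ring.poly_of_const (poly_ring R) X\<^bsub>R\<^esub>),
      ring.poly_of_const (poly_ring2 R) X\<^bsub>poly_ring R\<^esub>,
      X\<^bsub>poly_ring2 R\<^esub>)"

definition qpoly :: "'a ring \<Rightarrow> 'a qform \<Rightarrow> 'a list list list" where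
  "qpoly R Q = qeval (poly_ring3 R) (map_qform (const3 R) Q) (vars3 R)"

text \<open>The library embeds a field \<open>F\<close> into \<open>field.alg_closure F\<close> by \<open>ring.indexed_const F\<close>.\<close>

definition qbase_change
  :: "'a ring \<Rightarrow> 'a qform \<Rightarrow> (('a list \<times> nat) multiset \<Rightarrow> 'a) qform" where
  "qbase_change F Q = map_qform (ring.indexed_const F) Q"

definition geom_irreducible :: "'a ring \<Rightarrow> 'a qform \<Rightarrow> bool" where
  "geom_irreducible F Q \<longleftrightarrow>
     ring_irreducible\<^bsub>poly_ring3 (field.alg_closure F)\<^esub>
       (qpoly (field.alg_closure F) (qbase_change F Q))"


section \<open>The projective plane\<close>

definition nonzero_vecs :: "'a ring \<Rightarrow> ('a \<times> 'a \<times> 'a) set" where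
  "nonzero_vecs F =
     carrier F \<times> carrier F \<times> carrier F - {(\<zero>\<^bsub>F\<^esub>, \<zero>\<^bsub>F\<^esub>, \<zero>\<^bsub>F\<^esub>)}"

definition proj_rel :: "'a ring \<Rightarrow> (('a \<times> 'a \<times> 'a) \<times> ('a \<times> 'a \<times> 'a)) set" where
  "proj_rel F = {(u, v). u \<in> nonzero_vecs F \<and> v \<in> nonzero_vecs F \<and>
     (\<exists>k \<in> carrier F - {\<zero>\<^bsub>F\<^esub>}.
        v = (case u of (x, y, z) \<Rightarrow> (k \<otimes>\<^bsub>F\<^esub> x, k \<otimes>\<^bsub>F\<^esub> y, k \<otimes>\<^bsub>F\<^esub> z)))}"

definition proj_points :: "'a ring \<Rightarrow> ('a \<times> 'a \<times> 'a) set set" where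
  "proj_points F = nonzero_vecs F // proj_rel F"

text \<open>The line l X + m Y + n Z = 0 is given by its class [l : m : n] in the dual plane.\<close>

definition proj_lines :: "'a ring \<Rightarrow> ('a \<times> 'a \<times> 'a) set set" where
  "proj_lines F = nonzero_vecs F // proj_rel F"

fun lin_eval :: "'a ring \<Rightarrow> 'a \<times> 'a \<times> 'a \<Rightarrow> 'a \<times> 'a \<times> 'a \<Rightarrow> 'a" where
  "lin_eval F (l, m, n) (x, y, z) = l \<otimes>\<^bsub>F\<^esub> x \<oplus>\<^bsub>F\<^esub> m \<otimes>\<^bsub>F\<^esub> y \<oplus>\<^bsub>F\<^esub> n \<otimes>\<^bsub>F\<^esub> z"

text \<open>Vanishing does not depend on the chosen representatives.\<close>

definition on_line :: "'a ring \<Rightarrow> ('a \<times> 'a \<times> 'a) set \<Rightarrow> ('a \<times> 'a \<times> 'a) set \<Rightarrow> bool" where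
  "on_line F P L \<longleftrightarrow> (\<exists>v \<in> P. \<exists>l \<in> L. lin_eval F l v = \<zero>\<^bsub>F\<^esub>)"

definition on_conic :: "'a ring \<Rightarrow> ('a \<times> 'a \<times> 'a) set \<Rightarrow> 'a qform \<Rightarrow> bool" where
  "on_conic F P Q \<longleftrightarrow> (\<exists>v \<in> P. qeval F Q v = \<zero>\<^bsub>F\<^esub>)"


section \<open>Tangent lines, external and internal points\<close>

text \<open>The tangent line of a smooth conic at a point v has the gradient at v as its coefficient vector.
  A line over F is tangent if it is the tangent line at some geometric point of the conic.\<close>

definition is_tangent_vec :: "'k ring \<Rightarrow> 'k qform \<Rightarrow> 'k \<times> 'k \<times> 'k \<Rightarrow> bool" where
  "is_tangent_vec K Q l \<longleftrightarrow>
     (\<exists>v \<in> nonzero_vecs K. qeval K Q v = \<zero>\<^bsub>K\<^esub> \<and> (qgrad K Q v, l) \<in> proj_rel K)"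

definition is_tangent :: "'a ring \<Rightarrow> 'a qform \<Rightarrow> ('a \<times> 'a \<times> 'a) set \<Rightarrow> bool" where
  "is_tangent F Q L \<longleftrightarrow> (\<exists>(l, m, n) \<in> L.
     is_tangent_vec (field.alg_closure F) (qbase_change F Q)
       (ring.indexed_const F l, ring.indexed_const F m, ring.indexed_const F n))"

definition tangents_through :: "'a ring \<Rightarrow> 'a qform \<Rightarrow> ('a \<times> 'a \<times> 'a) set
    \<Rightarrow> ('a \<times> 'a \<times> 'a) set set" where
  "tangents_through F Q P = {L \<in> proj_lines F. on_line F P L \<and> is_tangent F Q L}"

definition external_pt :: "'a ring \<Rightarrow> 'a qform \<Rightarrow> ('a \<times> 'a \<times> 'a) set \<Rightarrow> bool" where
  "external_pt F Q P \<longleftrightarrow> \<not> on_conic F P Q \<and> card (tangents_through F Q P) = 2"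

definition internal_pt :: "'a ring \<Rightarrow> 'a qform \<Rightarrow> ('a \<times> 'a \<times> 'a) set \<Rightarrow> bool" where
  "internal_pt F Q P \<longleftrightarrow> \<not> on_conic F P Q \<and> tangents_through F Q P = {}"

end

theory Submission
  imports "HOL-Computational_Algebra.Polynomial" "HOL-Number_Theory.Residues" "HOL-Library.Cardinality" Defs
begin

text \<open>For a nonsingular form Q the tangents through a point v off the conic correspond to the points of
  the conic on the polar line of v. The restriction of Q to this line has discriminant -2 H Q(v) up to
  squares, where H is the Hessian determinant, so v is external iff -2 H Q(v) is a square and internal
  otherwise. The count is therefore a character sum, whose only nontrivial part is the sum of
  chi (C(v) D(v)), with chi the quadratic character. No Weil bound is needed for it: the level sets of
  C(v) / D(v) are the members of the pencil C - t D, a nondegenerate member has exactly q^2 zeros in the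
  affine 3-space, and at most three members are degenerate. This even gives the error O(q).\<close>

section \<open>The quadratic character\<close>

text \<open>Counting is done with vectors instead of projective points: the value of a quadratic
  form at a point is determined only up to nonzero squares, which the character does not see, and a
  division by q - 1 at the very end passes to points. The obstacle lies in the definitions:
  irreducibility and tangency refer to the algebraic closure, while the character sum lives in F.
  The bridge is the linear map that sends a vector to its gradient. A vector in its kernel would
  split the form into two linear factors over the closure, so irreducibility makes this map
  injective, over the closure and over F. Injectivity in turn forces the contact point of a tangent
  line with coefficients in F to be rational over F, up to a scalar, so that tangents can be counted
  by solutions over F.\<close>

class odd_finite_field = field + finite +
  assumes one_plus_one_neq_0: "1 + 1 \<noteq> 0"
begin

lemma two_neq_0 [simp]: "2 \<noteq> 0"
  using one_plus_one_neq_0 by simp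

lemma four_neq_0 [simp]: "4 \<noteq> 0"
proof -
  have "4 = 2 * 2" by simp
  then show ?thesis by (metis two_neq_0 no_zero_divisors)
qed

end

definition qchar :: "'f::field \<Rightarrow> int" where
  "qchar x = (if x = 0 then 0 else if \<exists>y. x = y * y then 1 else -1)"

lemma qchar_0 [simp]: "qchar 0 = 0"
  by (simp add: qchar_def)

lemma qchar_eq_0_iff [simp]: "qchar x = 0 \<longleftrightarrow> x = 0"
  by (simp add: qchar_def)

lemma qchar_square: "y \<noteq> 0 \<Longrightarrow> qchar (y * y) = 1"
  by (auto simp: qchar_def)

lemma qchar_eq_1_iff: "qchar x = 1 \<longleftrightarrow> x \<noteq> 0 \<and> (\<exists>y. x = y * y)"
  by (simp add: qchar_def)

lemma abs_qchar_le: "\<bar>qchar x\<bar> \<le> 1"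
  by (simp add: qchar_def)

lemma qchar_cases:
  obtains "x = 0" "qchar x = 0" | "x \<noteq> 0" "qchar x = 1" | "x \<noteq> 0" "qchar x = -1"
  unfolding qchar_def by (metis (full_types))

lemma card_square_roots:
  fixes x :: "'f::odd_finite_field"
  shows "int (card {y. y * y = x}) = 1 + qchar x"
proof (cases "\<exists>y. x = y * y")
  case True
  then obtain y where y: "x = y * y" by blast
  have eq: "{u. u * u = x} = {y, -y}"
    by (auto simp: y square_eq_iff)
  show ?thesis
  proof (cases "y = 0")
    case False
    have "y \<noteq> -y"
    proof
      assume "y = -y"
      then have "2 * y = 0" by (metis mult_2 add.right_inverse)
      then show False using False by simp
    qed
    then show ?thesis using False True by (simp add: eq) (auto simp: qchar_def y)
  next
    case True then show ?thesis using y eq by simp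
  qed
next
  case False
  then have "{y. y * y = x} = {}" "x \<noteq> 0" by auto
  then show ?thesis using False by (simp add: qchar_def)
qed

section \<open>Counting by fibres and the sum of the character\<close>

lemma card_eq_sum_fibres:
  fixes f :: "'a::finite \<Rightarrow> 'b::finite"
  shows "card {x. P x} = (\<Sum>y\<in>UNIV. card {x. P x \<and> f x = y})"
proof -
  have "{x. P x} = (\<Union>y. {x. P x \<and> f x = y})" by auto
  also have "card \<dots> = (\<Sum>y\<in>UNIV. card {x. P x \<and> f x = y})"
    by (rule card_UN_disjoint) auto
  finally show ?thesis .
qed

lemma card_triple_last:
  fixes P :: "'a::finite \<times> 'a \<times> 'a \<Rightarrow> bool"
  shows "card {v. P v} = (\<Sum>(x,y)\<in>UNIV. card {z. P (x,y,z)})"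
proof -
  have "card {v. P v} = (\<Sum>p\<in>UNIV. card {v. P v \<and> (fst v, fst (snd v)) = p})"
    by (rule card_eq_sum_fibres)
  also have "\<dots> = (\<Sum>(x,y)\<in>UNIV. card {z. P (x,y,z)})"
  proof (rule sum.cong)
    fix p :: "'a \<times> 'a"
    obtain x y where p: "p = (x,y)" by (cases p)
    have "{v. P v \<and> (fst v, fst (snd v)) = p} = (\<lambda>z. (x,y,z)) ` {z. P (x,y,z)}"
      by (auto simp: p image_iff)
    then show "card {v. P v \<and> (fst v, fst (snd v)) = p} = (case p of (x,y) \<Rightarrow> card {z. P (x,y,z)})"
      by (simp add: p card_image inj_on_def)
  qed simp
  finally show ?thesis .
qed

lemma card_pair_last:
  fixes P :: "'a::finite \<times> 'b::finite \<Rightarrow> bool"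
  shows "card {v. P v} = (\<Sum>x\<in>UNIV. card {y. P (x,y)})"
proof -
  have "card {v. P v} = (\<Sum>p\<in>UNIV. card {v. P v \<and> fst v = p})"
    by (rule card_eq_sum_fibres)
  also have "\<dots> = (\<Sum>x\<in>UNIV. card {y. P (x,y)})"
  proof (rule sum.cong)
    fix x :: "'a"
    have "{v. P v \<and> fst v = x} = (\<lambda>z. (x,z)) ` {z. P (x,z)}"
      by (auto simp: image_iff)
    then show "card {v. P v \<and> fst v = x} = card {z. P (x,z)}"
      by (simp add: card_image inj_on_def)
  qed simp
  finally show ?thesis .
qed

lemma sum_UNIV_pair:
  fixes f :: "'a::finite \<times> 'b::finite \<Rightarrow> 'c::comm_monoid_add"
  shows "(\<Sum>v\<in>UNIV. f v) = (\<Sum>x\<in>UNIV. \<Sum>y\<in>UNIV. f (x,y))"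
proof -
  have "(\<Sum>x\<in>UNIV. \<Sum>y\<in>UNIV. f (x,y)) = (\<Sum>(x,y)\<in>UNIV \<times> UNIV. f (x,y))"
    by (rule sum.cartesian_product)
  then show ?thesis by simp
qed

text \<open>The fibres of the squaring map partition the field, and the fibre over x has 1 +
  \<open>qchar\<close> x elements.\<close>

lemma sum_qchar: "(\<Sum>x\<in>UNIV. qchar (x::'f::odd_finite_field)) = 0"
proof -
  have "int (card (UNIV :: 'f set)) = (\<Sum>x\<in>UNIV. int (card {y::'f. y * y = x}))"
    using card_eq_sum_fibres[of "\<lambda>_. True" "\<lambda>y::'f. y * y"] by simp
  also have "\<dots> = int (card (UNIV :: 'f set)) + (\<Sum>x\<in>UNIV. qchar (x::'f))"
    by (simp add: card_square_roots sum.distrib)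
  finally show ?thesis by simp
qed

text \<open>Since the character sums to 0, there are as many nonzero squares as nonsquares.
  Multiplication by a nonsquare maps the squares injectively into the nonsquares, hence onto them,
  which leaves only squares as products of two nonsquares.\<close>

lemma qchar_mult:
  fixes x y :: "'f::odd_finite_field"
  shows "qchar (x * y) = qchar x * qchar y"
proof -
  define S where "S = {x::'f. qchar x = 1}"
  define N where "N = {x::'f. qchar x = -1}"
  have "(\<Sum>x\<in>UNIV. qchar (x::'f)) = (\<Sum>x\<in>UNIV. (if x \<in> S then 1 else 0) - (if x \<in> N then 1 else 0))"
    by (rule sum.cong) (auto simp: S_def N_def qchar_def)
  also have "\<dots> = int (card S) - int (card N)"
    by (simp add: sum_subtractf flip: sum.inter_filter)
  finally have card: "card S = card N" using sum_qchar[where 'f = 'f] by simp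
  have SS: "qchar (a * b) = 1" if *: "qchar a = 1" "qchar b = 1" for a b :: 'f
  proof -
    obtain u v where "a = u * u" "b = v * v" "a \<noteq> 0" "b \<noteq> 0"
      using * unfolding qchar_eq_1_iff by blast
    then have "a * b = (u * v) * (u * v)" "u * v \<noteq> 0" by auto
    then show ?thesis by (metis qchar_square)
  qed
  have SN: "qchar (a * b) = -1" if **: "qchar a = 1" "qchar b = -1" for a b :: 'f
  proof (rule ccontr)
    assume *: "qchar (a * b) \<noteq> -1"
    from ** have nz: "a \<noteq> 0" "b \<noteq> 0" by auto
    then have "a * b \<noteq> 0" by simp
    with * have 1: "qchar (a * b) = 1" by (cases "a * b" rule: qchar_cases) auto
    obtain u where u: "a = u * u" "u \<noteq> 0"
      using ** unfolding qchar_eq_1_iff by auto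
    have "qchar (inverse u * inverse u) = 1" using u by (intro qchar_square) simp
    from SS[OF this 1] have "qchar b = 1" using u by (simp add: field_simps)
    with ** show False by simp
  qed
  have NN: "qchar (a * b) = 1" if "qchar a = -1" "qchar b = -1" for a b :: 'f
  proof -
    from that have nz: "a \<noteq> 0" "b \<noteq> 0" by auto
    have "(*) a ` S \<subseteq> N" using SN that(1) by (auto simp: S_def N_def mult.commute)
    moreover have "card ((*) a ` S) = card S" using nz by (intro card_image) (auto simp: inj_on_def)
    ultimately have eq: "(*) a ` S = N" using card by (intro card_subset_eq) auto
    have "qchar (a * b) \<noteq> -1"
    proof
      assume "qchar (a * b) = -1"
      then have "a * b \<in> (*) a ` S" using eq by (simp add: N_def)
      then have "qchar b = 1" using nz by (auto simp: S_def)
      with that show False by simp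
    qed
    then show ?thesis using nz by (cases "a * b" rule: qchar_cases) auto
  qed
  show ?thesis
    by (cases x rule: qchar_cases; cases y rule: qchar_cases)
       (use SS SN NN SN[of y x] in \<open>auto simp: mult.commute\<close>)
qed

lemma qchar_mult_square: "y \<noteq> 0 \<Longrightarrow> qchar (y * y * x) = qchar (x::'f::odd_finite_field)"
  by (simp add: qchar_mult[of "y * y"] qchar_square)

section \<open>Roots of quadratic polynomials and character sums over their values\<close>

lemma card_hyperbola:
  fixes c :: "'f::odd_finite_field"
  assumes "c \<noteq> 0"
  shows "card {(s,t). s * t = c} = CARD('f) - 1"
proof -
  have "{(s,t). s * t = c} = (\<lambda>s. (s, c / s)) ` (UNIV - {0})"
    using assms by (auto simp: image_iff field_simps)
  also have "card \<dots> = CARD('f) - 1"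
    by (subst card_image) (auto simp: inj_on_def card_Diff_singleton)
  finally show ?thesis .
qed

text \<open>Double count of the curve u^2 = y^2 - c: by the number of square roots over each y it
  has q points plus the sum, and as a hyperbola it has q - 1.\<close>

lemma sum_qchar_square_minus:
  fixes c :: "'f::odd_finite_field"
  assumes "c \<noteq> 0"
  shows "(\<Sum>y\<in>UNIV. qchar (y * y - c)) = -1"
proof -
  let ?A = "{v::'f \<times> 'f. snd v * snd v = fst v * fst v - c}"
  have "int (card ?A) = (\<Sum>y\<in>UNIV. int (card {u::'f. u * u = y * y - c}))"
    by (subst card_pair_last) simp
  also have "\<dots> = int CARD('f) + (\<Sum>y\<in>UNIV. qchar (y * y - c))"
    by (simp add: card_square_roots sum.distrib)
  finally have 1: "int (card ?A) = int CARD('f) + (\<Sum>y\<in>UNIV. qchar (y * y - c))" .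
  \<comment> \<open>The factorisation (y - u)(y + u) = c; the inverse map divides by 2.\<close>
  have "bij_betw (\<lambda>(y,u). (y - u, y + u)) ?A {(s,t). s * t = c}"
  proof (rule bij_betw_byWitness[where f' = "\<lambda>(s,t). ((s + t) / 2, (t - s) / 2)"])
    show "(\<lambda>(y, u). (y - u, y + u)) ` ?A \<subseteq> {(s,t). s * t = c}"
      by (auto simp: algebra_simps)
    show "(\<lambda>(s,t). ((s + t) / 2, (t - s) / 2)) ` {(s,t). s * t = c} \<subseteq> ?A"
      by (auto simp: field_simps)
  qed (auto simp: field_simps)
  then have "card ?A = CARD('f) - 1"
    using card_hyperbola[OF assms] by (simp add: bij_betw_same_card)
  moreover have "CARD('f) \<ge> 1" by (simp add: Suc_leI)
  ultimately show ?thesis using 1 by simp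
qed

lemma sum_affine_reindex:
  fixes g :: "'f::{field,finite} \<Rightarrow> 'b::comm_monoid_add"
  assumes "a \<noteq> 0"
  shows "(\<Sum>x\<in>UNIV. g (a * x + b)) = (\<Sum>x\<in>UNIV. g x)"
  by (rule sum.reindex_bij_witness[where i = "\<lambda>x. (x - b) / a" and j = "\<lambda>x. a * x + b"])
     (use assms in auto)

lemma card_affine_reindex:
  fixes a :: "'f::field"
  assumes "a \<noteq> 0"
  shows "card {x. P (a * x + b)} = card {x. P x}"
proof -
  have "bij_betw (\<lambda>x. a * x + b) {x. P (a * x + b)} {x. P x}"
    by (rule bij_betw_byWitness[where f' = "\<lambda>x. (x - b) / a"]) (use assms in auto)
  then show ?thesis by (rule bij_betw_same_card)
qed

lemma card_roots_quadratic:
  fixes c m g :: "'f::odd_finite_field"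
  assumes "c \<noteq> 0"
  shows "int (card {z. c * (z * z) + m * z + g = 0}) = 1 + qchar (m * m - 4 * c * g)"
proof -
  have "c * (z * z) + m * z + g = 0 \<longleftrightarrow> (2 * c * z + m) * (2 * c * z + m) = m * m - 4 * c * g" for z
  proof -
    have "c * (z * z) + m * z + g = 0 \<longleftrightarrow> 4 * c * (c * (z * z) + m * z + g) = 0"
      using assms by simp
    also have "4 * c * (c * (z * z) + m * z + g) = (2 * c * z + m) * (2 * c * z + m) - (m * m - 4 * c * g)"
      by (simp add: algebra_simps)
    finally show ?thesis by simp
  qed
  then show ?thesis
    using card_affine_reindex[of "2 * c" "\<lambda>u. u * u = m * m - 4 * c * g" m] assms
    by (simp add: card_square_roots)
qed

lemma card_roots_linear:
  fixes m :: "'f::field"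
  assumes "m \<noteq> 0"
  shows "card {z. m * z + g = 0} = 1"
proof -
  have "{z. m * z + g = 0} = {- g / m}"
    using assms by (auto simp: field_simps eq_neg_iff_add_eq_0)
  then show ?thesis by simp
qed

lemma sum_qchar_affine:
  fixes a b :: "'f::odd_finite_field"
  assumes "a \<noteq> 0"
  shows "(\<Sum>x\<in>UNIV. qchar (a * x + b)) = 0"
  using sum_affine_reindex[OF assms, of qchar b] sum_qchar by simp

lemma sum_qchar_squares: "(\<Sum>x\<in>UNIV. qchar (x * x :: 'f::odd_finite_field)) = int CARD('f) - 1"
proof -
  have "(\<Sum>x\<in>UNIV. qchar (x * x :: 'f)) = (\<Sum>x\<in>UNIV. if x = (0::'f) then 0 else 1)"
    by (rule sum.cong) (auto simp: qchar_square)
  also have "\<dots> = (\<Sum>x\<in>UNIV-{0::'f}. 1)"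
    by (rule sum.mono_neutral_cong_right) auto
  also have "\<dots> = int CARD('f) - 1"
    by (simp add: card_Diff_singleton Suc_leI of_nat_diff)
  finally show ?thesis .
qed

text \<open>Summed over x for fixed y. If A is nonzero, completing the square turns each of the q -
  1 rows with nonzero y into \<open>sum_qchar_square_minus\<close> and yields - \<open>qchar\<close>
  A, which cancels the contribution (q - 1) \<open>qchar\<close> A of the row y = 0. If A = 0, each
  row is affine in x with nonzero slope, or identically 0 for y = 0.\<close>

lemma sum_qchar_binary:
  fixes A B C :: "'f::odd_finite_field"
  assumes "B * B - 4 * A * C \<noteq> 0"
  shows "(\<Sum>(x,y)\<in>UNIV. qchar (A * (x * x) + B * (x * y) + C * (y * y))) = 0"
proof -
  define g where "g x y = A * (x * x) + B * (x * y) + C * (y * y)" for x y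
  have swap: "(\<Sum>(x,y)\<in>UNIV. qchar (g x y)) = (\<Sum>y\<in>UNIV. \<Sum>x\<in>UNIV. qchar (g x y))"
    by (simp add: sum_UNIV_pair) (rule sum.swap)
  have split0: "(\<Sum>y\<in>UNIV. h y) = h 0 + (\<Sum>y\<in>UNIV-{0}. h y)" for h :: "'f \<Rightarrow> int"
    by (rule sum.remove) auto
  show ?thesis
  proof (cases "A = 0")
    case True
    then have B: "B \<noteq> 0" using assms by auto
    have "(\<Sum>x\<in>UNIV. qchar (g x y)) = 0" for y
    proof (cases "y = 0")
      case False
      have "g x y = (B * y) * x + C * y * y" for x
        by (simp add: g_def True algebra_simps)
      then show ?thesis using sum_qchar_affine[of "B * y" "C * y * y"] B False by simp
    qed (simp add: g_def True)
    then show ?thesis using swap by (simp add: g_def)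
  next
    case False
    have "(\<Sum>x\<in>UNIV. qchar (g x y)) = (if y = 0 then qchar A * (int CARD('f) - 1) else - qchar A)" for y
    proof (cases "y = 0")
      case True
      have "(\<Sum>x\<in>UNIV. qchar (g x y)) = qchar A * (\<Sum>x\<in>UNIV. qchar (x * x :: 'f))"
        by (simp add: g_def True qchar_mult sum_distrib_left)
      then show ?thesis using True by (simp add: sum_qchar_squares)
    next
      case y: False
      have "qchar (g x y) = qchar A * qchar ((2 * A * x + B * y) * (2 * A * x + B * y) - (B * B - 4 * A * C) * (y * y))" for x
      proof -
        have "(2 * A * x + B * y) * (2 * A * x + B * y) - (B * B - 4 * A * C) * (y * y) = (2 * 2) * (A * g x y)"
          by (simp add: g_def algebra_simps)
        then have "qchar A * qchar ((2 * A * x + B * y) * (2 * A * x + B * y) - (B * B - 4 * A * C) * (y * y))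
            = qchar A * (qchar A * qchar (g x y))"
          by (simp only: qchar_mult_square[OF two_neq_0]) (simp only: qchar_mult)
        also have "\<dots> = qchar (g x y)"
          using False by (cases A rule: qchar_cases) auto
        finally show ?thesis ..
      qed
      then have "(\<Sum>x\<in>UNIV. qchar (g x y))
          = qchar A * (\<Sum>x\<in>UNIV. qchar ((2 * A * x + B * y) * (2 * A * x + B * y) - (B * B - 4 * A * C) * (y * y)))"
        by (simp add: sum_distrib_left)
      also have "\<dots> = qchar A * (\<Sum>x\<in>UNIV. qchar (x * x - (B * B - 4 * A * C) * (y * y)))"
        using sum_affine_reindex[of "2 * A" "\<lambda>u. qchar (u * u - (B * B - 4 * A * C) * (y * y))" "B * y"] False
        by simp
      also have "\<dots> = - qchar A"
        using assms y by (subst sum_qchar_square_minus) auto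
      finally show ?thesis using y by simp
    qed
    then have "(\<Sum>(x,y)\<in>UNIV. qchar (g x y)) = (\<Sum>y\<in>UNIV. if y = (0::'f) then qchar A * (int CARD('f) - 1) else - qchar A)"
      using swap by simp
    also have "\<dots> = 0"
      by (subst split0) (simp add: card_Diff_singleton Suc_leI of_nat_diff algebra_simps)
    finally show ?thesis by (simp add: g_def)
  qed
qed

section \<open>Pencils of ternary quadratic forms\<close>

text \<open>\<open>qval\<close>, \<open>qpolar\<close> and \<open>dot\<close> are the type-class
  counterparts of \<open>qeval\<close>, \<open>qgrad\<close> and \<open>lin_eval\<close>;
  \<open>type_ring_eval\<close> identifies them.\<close>

fun qval :: "'f::field qform \<Rightarrow> 'f \<times> 'f \<times> 'f \<Rightarrow> 'f" where
  "qval (QForm a b c d e f) (x, y, z) =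
     a * (x * x) + b * (y * y) + c * (z * z) + d * (y * z) + e * (x * z) + f * (x * y)"

fun qpolar :: "'f::field qform \<Rightarrow> 'f \<times> 'f \<times> 'f \<Rightarrow> 'f \<times> 'f \<times> 'f" where
  "qpolar (QForm a b c d e f) (x, y, z) =
     (a * x + a * x + e * z + f * y, b * y + b * y + d * z + f * x, c * z + c * z + d * y + e * x)"

fun dot :: "'f::field \<times> 'f \<times> 'f \<Rightarrow> 'f \<times> 'f \<times> 'f \<Rightarrow> 'f" where
  "dot (l, m, n) (x, y, z) = l * x + m * y + n * z"

text \<open>The determinant of the symmetric matrix with rows (2a, f, e), (f, 2b, d), (e, d, 2c).
  The sort is that of commutative rings because the determinant is also taken over polynomials in
  the parameter of a pencil.\<close>

fun qhess :: "'f::comm_ring_1 qform \<Rightarrow> 'f" where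
  "qhess (QForm a b c d e f) =
     8 * (a * b * c) + 2 * (d * e * f) - 2 * (a * d * d) - 2 * (b * e * e) - 2 * (c * f * f)"

fun qpencil :: "'f::comm_ring_1 qform \<Rightarrow> 'f \<Rightarrow> 'f qform \<Rightarrow> 'f qform" where
  "qpencil (QForm a b c d e f) t (QForm a' b' c' d' e' f') =
     QForm (a - t * a') (b - t * b') (c - t * c') (d - t * d') (e - t * e') (f - t * f')"

lemma qval_qpencil: "qval (qpencil C t D) v = qval C v - t * qval D v"
  by (cases C; cases D; cases v) (simp add: algebra_simps)

lemma card_line:
  fixes d e :: "'f::odd_finite_field"
  assumes "d \<noteq> 0 \<or> e \<noteq> 0"
  shows "card {v. d * snd v + e * fst v = 0} = CARD('f)"
proof (cases "d = 0")
  case True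
  then have "{v. d * snd v + e * fst v = 0} = {0} \<times> UNIV"
    using assms by auto
  then show ?thesis by (simp add: card_cartesian_product)
next
  case False
  have "card {v. d * snd v + e * fst v = 0} = (\<Sum>x\<in>UNIV. card {y. d * y + e * x = 0})"
    by (subst card_pair_last) simp
  also have "\<dots> = CARD('f)"
    using card_roots_linear[OF False] by simp
  finally show ?thesis .
qed

text \<open>Projection along z. If c is nonzero, the fibre over (x, y) has 1 + \<open>qchar\<close>
  of a discriminant, which is itself a nondegenerate binary form in x and y, so the character part
  sums to 0. If c = 0, the equation is linear in z: one solution off the line m = 0, none on it
  except over the origin, where all q values of z occur; in total (q^2 - q) + q.\<close>

lemma card_zeros_nondegenerate:
  fixes Q :: "'f::odd_finite_field qform"
  assumes "qhess Q \<noteq> 0"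
  shows "card {v. qval Q v = 0} = CARD('f) ^ 2"
proof -
  obtain a b c d e f where Q: "Q = QForm a b c d e f" by (cases Q)
  define m where "m x y = d * y + e * x" for x y
  define g where "g x y = a * (x * x) + b * (y * y) + f * (x * y)" for x y
  have val: "qval Q (x, y, z) = c * (z * z) + m x y * z + g x y" for x y z
    by (simp add: Q m_def g_def algebra_simps)
  have sum: "card {v. qval Q v = 0} = (\<Sum>(x,y)\<in>UNIV. card {z. c * (z * z) + m x y * z + g x y = 0})"
    by (subst card_triple_last) (simp only: val)
  show ?thesis
  proof (cases "c = 0")
    case False
    have disc: "m x y * m x y - 4 * c * g x y
        = (e * e - 4 * c * a) * (x * x) + (2 * d * e - 4 * c * f) * (x * y) + (d * d - 4 * c * b) * (y * y)" for x y
      by (simp add: m_def g_def algebra_simps)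
    have "(2 * d * e - 4 * c * f) * (2 * d * e - 4 * c * f) - 4 * (e * e - 4 * c * a) * (d * d - 4 * c * b)
        = - 8 * c * qhess Q"
      by (simp add: Q algebra_simps)
    then have nz: "(2 * d * e - 4 * c * f) * (2 * d * e - 4 * c * f) - 4 * (e * e - 4 * c * a) * (d * d - 4 * c * b) \<noteq> 0"
    proof -
      have "(8::'f) = 2 * 4" by simp
      then have "(8::'f) \<noteq> 0" by (metis two_neq_0 four_neq_0 no_zero_divisors)
      then show ?thesis
        using \<open>_ = - 8 * c * qhess Q\<close> False assms by simp
    qed
    have "int (card {v. qval Q v = 0}) = (\<Sum>(x,y)\<in>UNIV. 1 + qchar (m x y * m x y - 4 * c * g x y))"
      by (simp add: sum case_prod_unfold card_roots_quadratic[OF False])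
    also have "\<dots> = int (CARD('f \<times> 'f)) + (\<Sum>(x,y)\<in>UNIV. qchar (m x y * m x y - 4 * c * g x y))"
      by (simp add: case_prod_unfold sum.distrib)
    also have "(\<Sum>(x,y)\<in>UNIV. qchar (m x y * m x y - 4 * c * g x y)) = 0"
      unfolding disc by (rule sum_qchar_binary[OF nz])
    finally have "int (card {v. qval Q v = 0}) = int (CARD('f) * CARD('f))"
      by simp
    then show ?thesis by (simp only: of_nat_eq_iff power2_eq_square)
  next
    case c: True
    have hess: "qhess Q = - 2 * (a * d * d + b * e * e - d * e * f)"
      by (simp add: Q c algebra_simps)
    have card: "card {z. c * (z * z) + m x y * z + g x y = 0}
        = (if (x, y) = (0, 0) then CARD('f) else if m x y = 0 then 0 else 1)" for x y
    proof (cases "m x y = 0")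
      case False
      then have "\<not> (x = 0 \<and> y = 0)" by (auto simp: m_def)
      then show ?thesis using card_roots_linear[OF False] False c by auto
    next
      case True
      show ?thesis
      proof (cases "(x, y) = (0, 0)")
        case True then show ?thesis by (simp add: m_def g_def c)
      next
        case nz: False
        have "g x y \<noteq> 0"
        proof
          assume g0: "g x y = 0"
          have dy: "d * y = - (e * x)" using True by (simp add: m_def eq_neg_iff_add_eq_0)
          \<comment> \<open>On the line d y = - e x both d^2 g and e^2 g are the same constant, - H
            / 2 with H = \<open>qhess Q\<close>, times x^2 and y^2. A zero of g away from the origin
            would thus force H = 0.\<close>
          have "(a * d * d + b * e * e - d * e * f) * (x * x) = d * d * g x y"
          proof -
            have "d * d * g x y = a * d * d * (x * x) + b * ((d * y) * (d * y)) + f * d * x * (d * y)"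
              by (simp add: g_def algebra_simps)
            also have "\<dots> = (a * d * d + b * e * e - d * e * f) * (x * x)"
              by (simp add: dy algebra_simps)
            finally show ?thesis ..
          qed
          moreover have "(a * d * d + b * e * e - d * e * f) * (y * y) = e * e * g x y"
          proof -
            have "e * e * g x y = a * ((e * x) * (e * x)) + b * e * e * (y * y) + f * e * y * (e * x)"
              by (simp add: g_def algebra_simps)
            also have "e * x = - (d * y)" using dy by simp
            finally show ?thesis by (simp add: algebra_simps)
          qed
          ultimately have "a * d * d + b * e * e - d * e * f = 0"
            using g0 nz by auto
          then show False using assms hess by simp
        qed
        then show ?thesis using True nz c by simp
      qed
    qed
    have de: "d \<noteq> 0 \<or> e \<noteq> 0" using assms hess by auto
    have lines: "card {v::'f \<times> 'f. m (fst v) (snd v) = 0} = CARD('f)"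
      unfolding m_def by (rule card_line[OF de])
    have "card {v. qval Q v = 0}
        = (\<Sum>v\<in>UNIV. if v = (0::'f, 0) then CARD('f) else if m (fst v) (snd v) = 0 then 0 else 1)"
      unfolding sum card by (simp add: case_prod_unfold prod_eq_iff)
    also have "\<dots> = CARD('f) + (\<Sum>v\<in>UNIV-{(0::'f,0)}. if m (fst v) (snd v) = 0 then 0 else 1)"
      by (subst sum.remove[of _ "(0,0)"]) auto
    also have "(\<Sum>v\<in>UNIV-{(0::'f,0)}. if m (fst v) (snd v) = 0 then 0 else (1::nat))
        = card (UNIV - {v::'f \<times> 'f. m (fst v) (snd v) = 0})"
    proof -
      have "(\<Sum>v\<in>UNIV-{(0::'f,0)}. if m (fst v) (snd v) = 0 then 0 else (1::nat))
          = (\<Sum>v\<in>UNIV - {v::'f \<times> 'f. m (fst v) (snd v) = 0}. 1)"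
        by (rule sum.mono_neutral_cong_right) (auto simp: m_def)
      then show ?thesis by simp
    qed
    also have "\<dots> = CARD('f) * CARD('f) - CARD('f)"
      by (subst card_Diff_subset) (auto simp: lines)
    finally show ?thesis by (simp add: power2_eq_square)
  qed
qed

section \<open>Crude bounds for the zeros of degenerate forms\<close>

lemma qchar_le_1: "qchar x \<le> 1"
  by (simp add: qchar_def)

lemma card_roots_quadratic_le:
  fixes c m g :: "'f::odd_finite_field"
  assumes "c \<noteq> 0 \<or> m \<noteq> 0 \<or> g \<noteq> 0"
  shows "card {z. c * (z * z) + m * z + g = 0} \<le> 2"
proof (cases "c = 0")
  case False
  then show ?thesis
    using card_roots_quadratic[OF False, of m g] qchar_le_1[of "m * m - 4 * c * g"] by linarith
next
  case c: True
  show ?thesis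
  proof (cases "m = 0")
    case True then show ?thesis using c assms by simp
  next
    case False then show ?thesis using card_roots_linear[OF False, of g] c by simp
  qed
qed

text \<open>If C is nonzero, each row of fixed x holds at most two zeros. If C = 0, the row x = 0
  consists of zeros, but every other row holds at most one.\<close>

lemma card_binary_zeros_le:
  fixes A B C :: "'f::odd_finite_field"
  assumes "A \<noteq> 0 \<or> B \<noteq> 0 \<or> C \<noteq> 0"
  shows "card {(x,y). A * (x * x) + B * (x * y) + C * (y * y) = 0} \<le> 2 * CARD('f)"
proof -
  let ?N = "\<lambda>x. card {y. A * (x * x) + B * (x * y) + C * (y * y) = 0}"
  have eq: "card {(x,y). A * (x * x) + B * (x * y) + C * (y * y) = 0} = ?N 0 + (\<Sum>x\<in>UNIV-{0}. ?N x)"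
    by (subst card_pair_last, subst sum.remove[of _ 0]) simp_all
  have le: "?N x \<le> 2" if "A * (x * x) \<noteq> 0 \<or> B * x \<noteq> 0 \<or> C \<noteq> 0" for x
  proof -
    have "?N x = card {y. C * (y * y) + (B * x) * y + A * (x * x) = 0}"
      by (rule arg_cong[where f = card]) (auto simp: algebra_simps)
    also have "\<dots> \<le> 2" by (rule card_roots_quadratic_le) (use that in auto)
    finally show ?thesis .
  qed
  have pos: "CARD('f) \<ge> 1" by (simp add: Suc_leI)
  show ?thesis
  proof (cases "C = 0")
    case False
    have "(\<Sum>x\<in>UNIV-{0}. ?N x) \<le> (\<Sum>x\<in>UNIV-{0::'f}. 2)"
      by (rule sum_mono) (use le False in auto)
    also have "\<dots> = 2 * (CARD('f) - 1)" by (simp add: card_Diff_singleton)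
    finally show ?thesis using eq le[of 0] False pos by linarith
  next
    case True
    have le1: "?N x \<le> 1" if "x \<noteq> 0" for x
    proof (cases "B = 0")
      case True
      then show ?thesis using \<open>C = 0\<close> assms that by simp
    next
      case False
      have "?N x = card {y. (B * x) * y + A * (x * x) = 0}"
        by (rule arg_cong[where f = card]) (use True in \<open>auto simp: algebra_simps\<close>)
      then show ?thesis using card_roots_linear[of "B * x" "A * (x * x)"] False that by simp
    qed
    have "(\<Sum>x\<in>UNIV-{0}. ?N x) \<le> (\<Sum>x\<in>UNIV-{0::'f}. 1)"
      by (rule sum_mono) (use le1 in auto)
    also have "\<dots> = CARD('f) - 1" by (simp add: card_Diff_singleton)
    finally show ?thesis using eq True pos by simp
  qed
qed

text \<open>Over (x, y) there are at most two z unless the polynomial in z vanishes identically. The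
  exceptional set \<open>Z\<close> has at most 2 q elements, each with q values of z, which gives 2
  q^2 besides the 2 q^2 of the remaining fibres.\<close>

lemma card_zeros_le:
  fixes Q :: "'f::odd_finite_field qform"
  assumes "Q \<noteq> QForm 0 0 0 0 0 0"
  shows "card {v. qval Q v = 0} \<le> 4 * CARD('f) ^ 2"
proof -
  obtain a b c d e f where Q: "Q = QForm a b c d e f" by (cases Q)
  define m where "m x y = d * y + e * x" for x y
  define g where "g x y = a * (x * x) + f * (x * y) + b * (y * y)" for x y
  define Z where "Z = {(x, y). c = 0 \<and> m x y = 0 \<and> g x y = 0}"
  have sum: "card {v. qval Q v = 0} = (\<Sum>(x,y)\<in>UNIV. card {z. c * (z * z) + m x y * z + g x y = 0})"
    by (subst card_triple_last) (simp add: Q m_def g_def algebra_simps)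
  have Z: "card Z \<le> 2 * CARD('f)"
  proof (cases "c = 0 \<and> d = 0 \<and> e = 0")
    case True
    then have "Z = {(x, y). a * (x * x) + f * (x * y) + b * (y * y) = 0}"
      by (simp add: Z_def m_def g_def)
    moreover have "a \<noteq> 0 \<or> f \<noteq> 0 \<or> b \<noteq> 0" using assms Q True by auto
    ultimately show ?thesis using card_binary_zeros_le[of a f b] by simp
  next
    case False
    show ?thesis
    proof (cases "c = 0")
      case True
      have "Z \<subseteq> {v. m (fst v) (snd v) = 0}" by (auto simp: Z_def)
      then have "card Z \<le> card {v. m (fst v) (snd v) = 0}" by (intro card_mono) auto
      also have "\<dots> = CARD('f)" unfolding m_def by (rule card_line) (use True False in auto)
      finally show ?thesis by simp
    qed (simp add: Z_def)
  qed
  have "card {v. qval Q v = 0} \<le> (\<Sum>p\<in>UNIV. if p \<in> Z then CARD('f) else 2)"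
    unfolding sum
  proof (rule sum_mono)
    fix p :: "'f \<times> 'f"
    obtain x y where p: "p = (x, y)" by (cases p)
    show "(case p of (x,y) \<Rightarrow> card {z. c * (z * z) + m x y * z + g x y = 0}) \<le> (if p \<in> Z then CARD('f) else 2)"
      using card_roots_quadratic_le[of c "m x y" "g x y"] by (auto simp: p Z_def card_mono)
  qed
  also have "\<dots> = CARD('f) * card Z + 2 * card (- Z)"
    by (simp add: sum.If_cases Compl_eq_Diff_UNIV)
  also have "\<dots> \<le> CARD('f) * (2 * CARD('f)) + 2 * (CARD('f) * CARD('f))"
  proof -
    have "card (- Z) \<le> CARD('f \<times> 'f)" by (intro card_mono) auto
    then show ?thesis using Z by (intro add_mono mult_left_mono) auto
  qed
  finally show ?thesis by (simp add: power2_eq_square)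
qed

text \<open>The determinant of C - t D is a polynomial in t of degree at most 3, and it is not the
  zero polynomial because its value at t = 0 is \<open>qhess C\<close>.\<close>

lemma qhess_qpencil:
  assumes "qhess (C :: 'f::odd_finite_field qform) \<noteq> 0"
  shows "card {t. qhess (qpencil C t D) = 0} \<le> 3"
proof -
  obtain a b c d e f where C: "C = QForm a b c d e f" by (cases C)
  obtain a' b' c' d' e' f' where D: "D = QForm a' b' c' d' e' f'" by (cases D)
  \<comment> \<open>The same determinant, evaluated over the polynomial ring at the indeterminate
    t.\<close>
  define p where "p = qhess (qpencil (QForm [:a:] [:b:] [:c:] [:d:] [:e:] [:f:]) [:0, 1:]
      (QForm [:a':] [:b':] [:c':] [:d':] [:e':] [:f':]))"
  have poly: "poly p t = qhess (qpencil C t D)" for t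
    by (simp add: p_def C D algebra_simps)
  have "poly p 0 \<noteq> 0" using assms by (simp add: poly) (simp add: C D)
  then have p0: "p \<noteq> 0" by auto
  have lin: "Polynomial.degree ([:u:] - [:0, 1:] * [:w:]) \<le> 1" for u w :: 'f
    by (simp add: degree_diff_le)
  have deg: "Polynomial.degree (numeral k * (u * v * w)) \<le> 3" if "Polynomial.degree u \<le> 1" "Polynomial.degree v \<le> 1" "Polynomial.degree w \<le> 1"
    for k and u v w :: "'f poly"
  proof -
    have "Polynomial.degree (numeral k * (u * v * w)) \<le> Polynomial.degree (u * v * w)"
      using degree_mult_le[of "numeral k" "u * v * w"] by simp
    then show ?thesis
      using degree_mult_le[of "u * v" w] degree_mult_le[of u v] that by linarith
  qed
  have "Polynomial.degree p \<le> 3"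
    unfolding p_def qhess.simps qpencil.simps
    by (intro degree_add_le degree_diff_le deg lin)
  then show ?thesis
    using card_poly_roots_bound[OF p0] by (simp add: poly)
qed

lemma map_qform_scale_iff_pencil:
  "C = map_qform ((*) t) D \<longleftrightarrow> qpencil C t D = QForm 0 0 0 0 0 (0 :: 'f::field)"
  by (cases C; cases D) auto

text \<open>Sorted by t = C v / D v the sum becomes the sum over t of qchar t times the number of zeros of
  C - t D outside the base locus. A nondegenerate member contributes the same number for every t, and
  qchar sums to 0, so only the at most three degenerate members matter.\<close>

lemma abs_sum_qchar_mult_le:
  fixes C D :: "'f::odd_finite_field qform"
  assumes "qhess C \<noteq> 0" and indep: "\<And>t. C \<noteq> map_qform ((*) t) D"
  shows "\<bar>\<Sum>v\<in>UNIV. qchar (qval C v * qval D v)\<bar> \<le> 9 * int CARD('f) ^ 2"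
proof -
  define N where "N t = card {v. qval (qpencil C t D) v = 0}" for t
  define B where "B = {v. qval C v = 0 \<and> qval D v = 0}"
  define bad where "bad = {t. qhess (qpencil C t D) = 0}"
  \<comment> \<open>Product and quotient differ by the square y^2; for y = 0 both are 0 because x /
    0 = 0.\<close>
  have quot: "qchar (x * y) = qchar (x / y)" for x y :: 'f
  proof (cases "y = 0")
    case False
    then have "x * y = y * y * (x / y)" by simp
    then show ?thesis using False by (metis qchar_mult_square)
  qed simp
  \<comment> \<open>For nonzero t the convention x / 0 = 0 keeps the zeros of D out of the fibre,
    and the zeros of C - t D at which D vanishes are exactly the base locus
    \<open>B\<close>.\<close>
  have fibre: "card {v. qval C v / qval D v = t} = N t - card B" "card B \<le> N t" if "t \<noteq> 0" for t
  proof -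
    have "{v. qval C v / qval D v = t} = {v. qval (qpencil C t D) v = 0} - B"
      using that by (auto simp: qval_qpencil B_def split: if_splits)
    moreover have "B \<subseteq> {v. qval (qpencil C t D) v = 0}"
      by (auto simp: qval_qpencil B_def)
    ultimately show "card {v. qval C v / qval D v = t} = N t - card B" "card B \<le> N t"
      by (simp_all add: N_def card_Diff_subset card_mono)
  qed
  have "(\<Sum>v\<in>UNIV. qchar (qval C v * qval D v)) = (\<Sum>v\<in>UNIV. qchar (qval C v / qval D v))"
    by (simp add: quot)
  also have "\<dots> = (\<Sum>t\<in>UNIV. \<Sum>v\<in>{v \<in> UNIV. qval C v / qval D v = t}. qchar (qval C v / qval D v))"
    by (rule sum.group[symmetric]) auto
  also have "\<dots> = (\<Sum>t\<in>UNIV. qchar t * (int (N t) - int (card B)))"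
  proof (rule sum.cong)
    fix t :: 'f
    have "(\<Sum>v\<in>{v \<in> UNIV. qval C v / qval D v = t}. qchar (qval C v / qval D v))
        = int (card {v. qval C v / qval D v = t}) * qchar t"
      by simp
    then show "(\<Sum>v\<in>{v \<in> UNIV. qval C v / qval D v = t}. qchar (qval C v / qval D v))
        = qchar t * (int (N t) - int (card B))"
      by (cases "t = 0") (simp_all add: fibre of_nat_diff)
  qed simp
  also have "\<dots> = (\<Sum>t\<in>UNIV. qchar t * (int (N t) - int CARD('f) ^ 2) + (int CARD('f) ^ 2 - int (card B)) * qchar t)"
    by (simp add: algebra_simps)
  also have "\<dots> = (\<Sum>t\<in>UNIV. qchar t * (int (N t) - int CARD('f) ^ 2))"
    by (simp add: sum.distrib sum_qchar flip: sum_distrib_left)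
  also have "\<dots> = (\<Sum>t\<in>bad. qchar t * (int (N t) - int CARD('f) ^ 2))"
    by (rule sum.mono_neutral_right) (auto simp: bad_def N_def card_zeros_nondegenerate)
  finally have eq: "(\<Sum>v\<in>UNIV. qchar (qval C v * qval D v))
      = (\<Sum>t\<in>bad. qchar t * (int (N t) - int CARD('f) ^ 2))" .
  \<comment> \<open>\<open>N t\<close> lies between 0 and 4 q^2, so it is off from q^2 by at most 3
    q^2; three degenerate members then give the constant 9.\<close>
  have "\<bar>qchar t * (int (N t) - int CARD('f) ^ 2)\<bar> \<le> 3 * int CARD('f) ^ 2" for t
  proof -
    have "N t \<le> 4 * CARD('f) ^ 2"
      unfolding N_def using indep[of t] map_qform_scale_iff_pencil[of C t D] by (intro card_zeros_le) blast
    then have "int (N t) \<le> 4 * int CARD('f) ^ 2" 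
      using of_nat_mono[of "N t" "4 * CARD('f) ^ 2", where 'a = int] by simp
    then have "\<bar>int (N t) - int CARD('f) ^ 2\<bar> \<le> 3 * int CARD('f) ^ 2" by auto
    moreover have "\<bar>qchar t\<bar> * \<bar>int (N t) - int CARD('f) ^ 2\<bar> \<le> 1 * \<bar>int (N t) - int CARD('f) ^ 2\<bar>"
      by (rule mult_right_mono) (simp_all add: abs_qchar_le)
    ultimately show ?thesis by (simp add: abs_mult)
  qed
  then have "(\<Sum>t\<in>bad. \<bar>qchar t * (int (N t) - int CARD('f) ^ 2)\<bar>) \<le> (\<Sum>t\<in>bad. 3 * int CARD('f) ^ 2)"
    by (intro sum_mono)
  also have "\<dots> \<le> 3 * (3 * int CARD('f) ^ 2)"
    using qhess_qpencil[OF assms(1), of D] by (simp add: bad_def mult_right_mono)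
  finally show ?thesis
    unfolding eq using sum_abs[of "\<lambda>t. qchar t * (int (N t) - int CARD('f) ^ 2)" bad] by linarith
qed

text \<open>The sums of qchar (C v) and qchar (D v) are covered by the preceding lemma as well: up to
  O(q^2) vectors on which a factor vanishes they are the sums for the products with the form X^2.\<close>

lemma abs_card_qchar_le:
  fixes C D :: "'f::odd_finite_field qform"
  assumes C: "qhess C \<noteq> 0" and D: "qhess D \<noteq> 0" and indep: "\<And>t. C \<noteq> map_qform ((*) t) D"
  shows "\<bar>4 * int (card {v. qchar (qval C v) = 1 \<and> qchar (qval D v) = -1}) - int CARD('f) ^ 3\<bar>
    \<le> 33 * int CARD('f) ^ 2"
proof -
  let ?X = "QForm 1 0 0 0 0 (0::'f)"
  let ?q = "int CARD('f)"
  define S where "S = {v. qchar (qval C v) = 1 \<and> qchar (qval D v) = -1}"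
  \<comment> \<open>All multiples of X^2 have determinant 0.\<close>
  have indX: "Q \<noteq> map_qform ((*) t) ?X" if "qhess Q \<noteq> 0" for Q :: "'f qform" and t
    using that by auto
  \<comment> \<open>Where C, D and x do not vanish, 4 times the indicator of \<open>S\<close> is (1
    + \<open>qchar\<close> (C v)) (1 - \<open>qchar\<close> (D v)), and \<open>E\<close> is 0. Each
    vanishing factor costs at most 2 on q^2 vectors. With three character sums of size at most 9 q^2
    this gives 6 + 27 = 33.\<close>
  define E where "E v = 4 * of_bool (v \<in> S) - 1 - qchar (qval C v * qval ?X v)
     + qchar (qval D v * qval ?X v) + qchar (qval C v * qval D v)" for v
  have E: "\<bar>E v\<bar> \<le> 2 * of_bool (qval C v = 0) + 2 * of_bool (qval D v = 0) + 2 * of_bool (fst v = 0)" for v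
  proof -
    have X: "qchar (qval ?X v) = of_bool (fst v \<noteq> 0)"
      by (cases v) (auto simp: qchar_square)
    show ?thesis
      unfolding E_def S_def qchar_mult X
      by (cases "qval C v" rule: qchar_cases; cases "qval D v" rule: qchar_cases; cases "fst v = 0") auto
  qed
  have zeros: "(\<Sum>v\<in>UNIV. of_bool (P v)) = int (card {v. P v})" for P :: "'f \<times> 'f \<times> 'f \<Rightarrow> bool"
    by (simp add: Collect_neg_eq flip: sum.inter_filter) 
  have X0: "card {v :: 'f \<times> 'f \<times> 'f. fst v = 0} = CARD('f) ^ 2"
  proof -
    have "{v :: 'f \<times> 'f \<times> 'f. fst v = 0} = {0} \<times> UNIV" by auto
    then show ?thesis by (simp add: card_cartesian_product power2_eq_square)
  qed
  have "\<bar>\<Sum>v\<in>UNIV. E v\<bar> \<le> (\<Sum>v\<in>UNIV. \<bar>E v\<bar>)" by (rule sum_abs)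
  also have "\<dots> \<le> (\<Sum>v\<in>UNIV. 2 * of_bool (qval C v = 0) + 2 * of_bool (qval D v = 0) + 2 * of_bool (fst v = 0))"
    by (rule sum_mono) (rule E)
  also have "\<dots> = 6 * ?q ^ 2"
    by (simp add: sum.distrib zeros X0 card_zeros_nondegenerate[OF C] card_zeros_nondegenerate[OF D]
        flip: sum_distrib_left)
  finally have "\<bar>\<Sum>v\<in>UNIV. E v\<bar> \<le> 6 * ?q ^ 2" .
  moreover have "(\<Sum>v\<in>UNIV. E v) = 4 * int (card S) - ?q ^ 3
      - (\<Sum>v\<in>UNIV. qchar (qval C v * qval ?X v)) + (\<Sum>v\<in>UNIV. qchar (qval D v * qval ?X v))
      + (\<Sum>v\<in>UNIV. qchar (qval C v * qval D v))"
    unfolding E_def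
    by (simp only: sum.distrib sum_subtractf zeros flip: sum_distrib_left) (simp add: power3_eq_cube)
  ultimately show ?thesis
    using abs_sum_qchar_mult_le[OF C indX[OF C]] abs_sum_qchar_mult_le[OF D indX[OF D]]
      abs_sum_qchar_mult_le[OF C indep]
    unfolding S_def by linarith
qed

text \<open>Every row with nonzero y has 1 + \<open>qchar\<close> \<Delta> zeros, where \<Delta> is
  the discriminant, and the row y = 0 only the origin. If A = 0, the row y = 0 is full and the
  others have one zero each; this agrees with the formula because then \<Delta> = B^2 is a nonzero
  square.\<close>

lemma card_binary_zeros:
  fixes A B C :: "'f::odd_finite_field"
  assumes "B * B - 4 * A * C \<noteq> 0"
  shows "int (card {(x,y). A * (x * x) + B * (x * y) + C * (y * y) = 0})
    = 1 + (int CARD('f) - 1) * (1 + qchar (B * B - 4 * A * C))"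
proof -
  let ?\<Delta> = "B * B - 4 * A * C"
  let ?N = "\<lambda>y. card {x. A * (x * x) + (B * y) * x + C * (y * y) = 0}"
  have "bij_betw prod.swap {(x,y). A * (x * x) + B * (x * y) + C * (y * y) = 0}
      {(y,x). A * (x * x) + (B * y) * x + C * (y * y) = 0}"
    by (rule bij_betw_byWitness[where f' = prod.swap]) (auto simp: mult_ac)
  then have "card {(x,y). A * (x * x) + B * (x * y) + C * (y * y) = 0}
      = card {(y,x). A * (x * x) + (B * y) * x + C * (y * y) = 0}"
    by (rule bij_betw_same_card)
  also have "\<dots> = (\<Sum>y\<in>UNIV. ?N y)"
    by (subst card_pair_last) simp
  finally have "int (card {(x,y). A * (x * x) + B * (x * y) + C * (y * y) = 0}) = (\<Sum>y\<in>UNIV. int (?N y))"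
    by simp
  also have "\<dots> = int (?N 0) + (\<Sum>y\<in>UNIV-{0}. int (?N y))"
    by (rule sum.remove) auto
  also have "(\<Sum>y\<in>UNIV-{0}. int (?N y)) = (int CARD('f) - 1) * (if A = 0 then 1 else 1 + qchar ?\<Delta>)"
  proof -
    have "int (?N y) = (if A = 0 then 1 else 1 + qchar ?\<Delta>)" if y: "y \<noteq> 0" for y
    proof (cases "A = 0")
      case True
      then have "B * y \<noteq> 0" using assms y by auto
      then show ?thesis using card_roots_linear[of "B * y" "C * (y * y)"] True by simp
    next
      case False
      have "B * y * (B * y) - 4 * A * (C * (y * y)) = y * y * ?\<Delta>" by (simp add: algebra_simps)
      then show ?thesis
        using card_roots_quadratic[OF False, of "B * y" "C * (y * y)"] False y
        by (simp only: qchar_mult_square[OF y] if_False)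
    qed
    then show ?thesis by (simp add: card_Diff_singleton Suc_leI of_nat_diff)
  qed
  finally show ?thesis
    using assms by (cases "A = 0") (auto simp: qchar_square algebra_simps)
qed

section \<open>Counting tangent lines\<close>

text \<open>The points where the conic meets the polar line of \<open>v\<close>, each represented by
  its q - 1 nonzero vectors.\<close>

definition polar_zeros :: "'f::field qform \<Rightarrow> 'f \<times> 'f \<times> 'f \<Rightarrow> ('f \<times> 'f \<times> 'f) set" where
  "polar_zeros Q v = {w. w \<noteq> (0, 0, 0) \<and> qval Q w = 0 \<and> dot (qpolar Q v) w = 0}"

text \<open>Reciprocity of pole and polar: a point \<open>w\<close> of the conic lies on the polar
  line of \<open>v\<close> iff the tangent at \<open>w\<close> passes through
  \<open>v\<close>.\<close>

lemma dot_qpolar_commute: "dot (qpolar Q v) w = dot (qpolar Q w) v"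
  by (cases Q; cases v; cases w) (simp add: algebra_simps)

lemma dot_qpolar_self: "dot (qpolar Q v) v = 2 * qval Q v"
  by (cases Q; cases v) (simp add: algebra_simps)

lemma card_polar_zeros_aux:
  fixes Q :: "'f::odd_finite_field qform"
  assumes H: "qhess Q \<noteq> 0" and v: "qval Q v \<noteq> 0" and l: "qpolar Q v = (l1, l2, l3)" "l3 \<noteq> 0"
  shows "int (card (polar_zeros Q v)) = (int CARD('f) - 1) * (1 + qchar (- 2 * qhess Q * qval Q v))"
proof -
  obtain a b c d e f where Q: "Q = QForm a b c d e f" by (cases Q)
  obtain x0 y0 z0 where v0: "v = (x0, y0, z0)" by (cases v)
  \<comment> \<open>\<open>A\<close>, \<open>B\<close>, \<open>C\<close> are the coefficients of Q
    restricted to the polar line, with z eliminated and the denominator l3^2 cleared.\<close>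
  define A where "A = a * l3 * l3 - e * l1 * l3 + c * l1 * l1"
  define B where "B = f * l3 * l3 - d * l1 * l3 - e * l2 * l3 + 2 * c * l1 * l2"
  define C where "C = b * l3 * l3 - d * l2 * l3 + c * l2 * l2"
  define zz where "zz x y = - (l1 * x + l2 * y) / l3" for x y
  \<comment> \<open>With M the Hessian matrix and l = M v, the left side is l^T adj(M) l = v^T M
    adj(M) M v = det(M) v^T M v, and v^T M v = 2 Q(v).\<close>
  have adj: "(4 * b * c - d * d) * l1 * l1 + (4 * a * c - e * e) * l2 * l2 + (4 * a * b - f * f) * l3 * l3
     + 2 * (d * e - 2 * c * f) * l1 * l2 + 2 * (d * f - 2 * b * e) * l1 * l3 + 2 * (e * f - 2 * a * d) * l2 * l3
     = 2 * qhess Q * qval Q v"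
    using l by (auto simp: Q v0 algebra_simps)
  \<comment> \<open>The discriminant of a conic restricted to a line is, up to the square l3^2,
    minus the dual conic at that line.\<close>
  have disc: "B * B - 4 * A * C = l3 * l3 * (- 2 * qhess Q * qval Q v)"
  proof -
    have "B * B - 4 * A * C = - (l3 * l3) * ((4 * b * c - d * d) * l1 * l1 + (4 * a * c - e * e) * l2 * l2 + (4 * a * b - f * f) * l3 * l3
     + 2 * (d * e - 2 * c * f) * l1 * l2 + 2 * (d * f - 2 * b * e) * l1 * l3 + 2 * (e * f - 2 * a * d) * l2 * l3)"
      by (simp add: A_def B_def C_def algebra_simps)
    then show ?thesis unfolding adj by (simp add: algebra_simps)
  qed
  then have nz: "B * B - 4 * A * C \<noteq> 0" using H v l by simp
  have sub: "l3 * l3 * qval Q (x, y, zz x y) = A * (x * x) + B * (x * y) + C * (y * y)" for x y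
  proof -
    have z: "l3 * zz x y = - (l1 * x + l2 * y)" using l by (simp add: zz_def)
    have "l3 * l3 * qval Q (x, y, zz x y)
       = a * (x * x) * (l3 * l3) + b * (y * y) * (l3 * l3) + c * (l3 * zz x y) * (l3 * zz x y) + d * y * l3 * (l3 * zz x y)
         + e * x * l3 * (l3 * zz x y) + f * (x * y) * (l3 * l3)"
      by (simp add: Q algebra_simps)
    then show ?thesis unfolding z by (simp add: A_def B_def C_def algebra_simps)
  qed
  have "l3 * l3 \<noteq> 0" using l by simp
  then have val: "qval Q (x, y, zz x y) = 0 \<longleftrightarrow> A * (x * x) + B * (x * y) + C * (y * y) = 0" for x y
    using sub by (metis mult_eq_0_iff)
  have "bij_betw (\<lambda>(x, y). (x, y, zz x y))
     ({(x,y). A * (x * x) + B * (x * y) + C * (y * y) = 0} - {(0, 0)}) (polar_zeros Q v)"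
  proof (rule bij_betw_byWitness[where f' = "\<lambda>(x, y, z). (x, y)"])
    have zz: "z = zz x y" if "l1 * x + l2 * y + l3 * z = 0" for x y z
    proof -
      have "l3 * z = - (l1 * x + l2 * y)" using that by (metis add.commute eq_neg_iff_add_eq_0)
      then show ?thesis using l(2) by (simp add: zz_def nonzero_eq_divide_eq mult.commute)
    qed
    show "\<forall>w\<in>polar_zeros Q v. (\<lambda>(x, y). (x, y, zz x y)) ((\<lambda>(x, y, z). (x, y)) w) = w"
      by (auto simp: polar_zeros_def l(1) dest: zz)
    have zz0: "zz 0 0 = 0" by (simp add: zz_def)
    show "(\<lambda>(x, y, z). (x, y)) ` polar_zeros Q v
        \<subseteq> {(x,y). A * (x * x) + B * (x * y) + C * (y * y) = 0} - {(0, 0)}"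
    proof (intro subsetI, elim imageE)
      fix p w assume w: "w \<in> polar_zeros Q v" and p: "p = (\<lambda>(x, y, z). (x, y)) w"
      obtain x y z where xyz: "w = (x, y, z)" by (cases w)
      have z: "z = zz x y" using w by (intro zz) (simp add: polar_zeros_def xyz l(1))
      show "p \<in> {(x,y). A * (x * x) + B * (x * y) + C * (y * y) = 0} - {(0, 0)}"
        using w by (auto simp: p xyz polar_zeros_def z val zz0)
    qed
    have dotzz: "l1 * x + l2 * y + l3 * zz x y = 0" for x y using l(2) by (simp add: zz_def)
    show "(\<lambda>(x, y). (x, y, zz x y)) ` ({(x,y). A * (x * x) + B * (x * y) + C * (y * y) = 0} - {(0, 0)})
        \<subseteq> polar_zeros Q v"
      by (auto simp: polar_zeros_def l(1) dotzz val)
  qed auto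
  then have card_eq: "card (polar_zeros Q v) = card ({(x,y). A * (x * x) + B * (x * y) + C * (y * y) = 0} - {(0, 0)})"
    by (simp add: bij_betw_same_card)
  have "int (card (polar_zeros Q v)) = int (card {(x,y). A * (x * x) + B * (x * y) + C * (y * y) = 0}) - 1"
  proof -
    have "(0, 0) \<in> {(x,y). A * (x * x) + B * (x * y) + C * (y * y) = 0}" by simp
    then have "card {(x,y). A * (x * x) + B * (x * y) + C * (y * y) = 0} > 0"
      using card_gt_0_iff[of "{(x,y). A * (x * x) + B * (x * y) + C * (y * y) = 0}"] by fastforce
    then show ?thesis unfolding card_eq by (subst card_Diff_singleton) (auto simp: of_nat_diff)
  qed
  moreover have "qchar (B * B - 4 * A * C) = qchar (- 2 * qhess Q * qval Q v)"
    unfolding disc by (rule qchar_mult_square[OF l(2)])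
  ultimately show ?thesis
    using card_binary_zeros[OF nz] by simp
qed

text \<open>A cyclic permutation of the coordinates moves a nonzero coordinate of the polar line to the last
  position.\<close>

fun rotate_vec :: "'a \<times> 'a \<times> 'a \<Rightarrow> 'a \<times> 'a \<times> 'a" where
  "rotate_vec (x, y, z) = (y, z, x)"

fun rotate_form :: "'a qform \<Rightarrow> 'a qform" where
  "rotate_form (QForm a b c d e f) = QForm b c a e f d"

lemma rotate:
  "qval (rotate_form Q) (rotate_vec v) = qval Q v"
  "qpolar (rotate_form Q) (rotate_vec v) = rotate_vec (qpolar Q v)"
  "dot (rotate_vec v) (rotate_vec w) = dot v w"
  "qhess (rotate_form Q) = qhess Q"
  by (cases Q; cases v; cases w; simp add: algebra_simps)+

lemma card_polar_zeros_rotate: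
  "card (polar_zeros (rotate_form Q) (rotate_vec v)) = card (polar_zeros Q v)"
proof -
  have "bij_betw rotate_vec (polar_zeros Q v) (polar_zeros (rotate_form Q) (rotate_vec v))"
  proof (rule bij_betw_byWitness[where f' = "\<lambda>w. rotate_vec (rotate_vec w)"])
    show "(\<lambda>w. rotate_vec (rotate_vec w)) ` polar_zeros (rotate_form Q) (rotate_vec v) \<subseteq> polar_zeros Q v"
    proof (intro subsetI, elim imageE)
      fix u w assume w: "w \<in> polar_zeros (rotate_form Q) (rotate_vec v)" and u: "u = rotate_vec (rotate_vec w)"
      then have "w = rotate_vec u" by (cases w) simp
      with w have "rotate_vec u \<noteq> (0, 0, 0)" "qval Q u = 0" "dot (qpolar Q v) u = 0"
        by (simp_all add: polar_zeros_def rotate)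
      then show "u \<in> polar_zeros Q v" by (auto simp: polar_zeros_def)
    qed
    show "rotate_vec ` polar_zeros Q v \<subseteq> polar_zeros (rotate_form Q) (rotate_vec v)"
    proof (intro subsetI, elim imageE)
      fix u w assume w: "w \<in> polar_zeros Q v" and u: "u = rotate_vec w"
      have "u \<noteq> (0, 0, 0)" using w u by (cases w) (auto simp: polar_zeros_def)
      with w show "u \<in> polar_zeros (rotate_form Q) (rotate_vec v)"
        by (simp add: polar_zeros_def rotate u)
    qed
  qed auto
  then show ?thesis by (simp add: bij_betw_same_card)
qed

lemma card_polar_zeros:
  fixes Q :: "'f::odd_finite_field qform"
  assumes H: "qhess Q \<noteq> 0" and v: "qval Q v \<noteq> 0"
  shows "int (card (polar_zeros Q v)) = (int CARD('f) - 1) * (1 + qchar (- 2 * qhess Q * qval Q v))"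
proof -
  obtain l1 l2 l3 where l: "qpolar Q v = (l1, l2, l3)" by (cases "qpolar Q v")
  \<comment> \<open>By Euler's identity the polar vector pairs with \<open>v\<close> to 2 Q(v),
    which is nonzero.\<close>
  have "l1 \<noteq> 0 \<or> l2 \<noteq> 0 \<or> l3 \<noteq> 0"
    using dot_qpolar_self[of Q v] v l by (cases v) auto
  then consider "l3 \<noteq> 0" | "l1 \<noteq> 0" | "l2 \<noteq> 0" by blast
  then show ?thesis
  proof cases
    case 1 then show ?thesis using card_polar_zeros_aux[OF H v l] by simp
  next
    case 2 then show ?thesis
      using card_polar_zeros_aux[of "rotate_form Q" "rotate_vec v" l2 l3 l1] H v l
      by (simp add: rotate card_polar_zeros_rotate)
  next
    case 3 then show ?thesis
      using card_polar_zeros_aux[of "rotate_form (rotate_form Q)" "rotate_vec (rotate_vec v)" l3 l1 l2] H v l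
      by (simp add: rotate card_polar_zeros_rotate)
  qed
qed

text \<open>If the determinant is 0, the columns of the adjugate lie in the kernel, so a trivial
  kernel makes all 2 x 2 minors vanish. Then (f, -2a, 0) and (e, 0, -2a) lie in the kernel too,
  hence the first column (2a, f, e) is 0 and (1, 0, 0) is a nonzero kernel vector.\<close>

lemma qhess_neq_0:
  fixes Q :: "'f::field qform"
  assumes ker: "\<And>w. w \<noteq> (0, 0, 0) \<Longrightarrow> qpolar Q w \<noteq> (0, 0, 0)"
  shows "qhess Q \<noteq> 0"
proof
  assume H: "qhess Q = 0"
  obtain a b c d e f where Q: "Q = QForm a b c d e f" by (cases Q)
  have ker': "w = (0, 0, 0)" if "qpolar Q w = (0, 0, 0)" for w using ker that by blast
  have hess: "8 * (a * b * c) + 2 * (d * e * f) - 2 * (a * d * d) - 2 * (b * e * e) - 2 * (c * f * f) = 0"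
    using H by (simp add: Q)
  have "qpolar Q (4 * b * c - d * d, d * e - 2 * c * f, d * f - 2 * b * e) = (0, 0, 0)"
    using hess by (simp add: Q algebra_simps)
  from ker'[OF this] have 1: "4 * b * c - d * d = 0" "d * e - 2 * c * f = 0" "d * f - 2 * b * e = 0" by auto
  have "qpolar Q (d * e - 2 * c * f, 4 * a * c - e * e, e * f - 2 * a * d) = (0, 0, 0)"
    using hess by (simp add: Q algebra_simps)
  from ker'[OF this] have 2: "4 * a * c - e * e = 0" "e * f - 2 * a * d = 0" by auto
  have "qpolar Q (d * f - 2 * b * e, e * f - 2 * a * d, 4 * a * b - f * f) = (0, 0, 0)"
    using hess by (simp add: Q algebra_simps)
  from ker'[OF this] have 3: "4 * a * b - f * f = 0" by auto
  have "qpolar Q (f, - 2 * a, 0) = (0, 0, 0)" "qpolar Q (e, 0, - 2 * a) = (0, 0, 0)"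
    using 1 2 3 by (simp_all add: Q algebra_simps)
  from this[THEN ker'] have "f = 0" "e = 0" "2 * a = 0" by auto
  then have "qpolar Q (1, 0, 0) = (0, 0, 0)" by (simp add: Q)
  from ker'[OF this] show False by simp
qed

section \<open>Products of linear forms\<close>

text \<open>The coefficients are those of (l1 X + l2 Y + l3 Z)(m1 X + m2 Y + m3 Z); a factor may be
  0.\<close>

definition splits :: "('a, 'b) ring_scheme \<Rightarrow> 'a qform \<Rightarrow> bool" where
  "splits R Q \<longleftrightarrow> (\<exists>l1 l2 l3 m1 m2 m3. {l1, l2, l3, m1, m2, m3} \<subseteq> carrier R \<and>
     Q = QForm (l1 \<otimes>\<^bsub>R\<^esub> m1) (l2 \<otimes>\<^bsub>R\<^esub> m2) (l3 \<otimes>\<^bsub>R\<^esub> m3) (l2 \<otimes>\<^bsub>R\<^esub> m3 \<oplus>\<^bsub>R\<^esub> l3 \<otimes>\<^bsub>R\<^esub> m2)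
       (l1 \<otimes>\<^bsub>R\<^esub> m3 \<oplus>\<^bsub>R\<^esub> l3 \<otimes>\<^bsub>R\<^esub> m1) (l1 \<otimes>\<^bsub>R\<^esub> m2 \<oplus>\<^bsub>R\<^esub> l2 \<otimes>\<^bsub>R\<^esub> m1))"

lemma splitsI:
  fixes R (structure)
  assumes "l1 \<in> carrier R" "l2 \<in> carrier R" "l3 \<in> carrier R" "m1 \<in> carrier R" "m2 \<in> carrier R" "m3 \<in> carrier R"
    and "a = l1 \<otimes> m1" "b = l2 \<otimes> m2" "c = l3 \<otimes> m3" "d = l2 \<otimes> m3 \<oplus> l3 \<otimes> m2"
      "e = l1 \<otimes> m3 \<oplus> l3 \<otimes> m1" "f = l1 \<otimes> m2 \<oplus> l2 \<otimes> m1"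
  shows "splits R (QForm a b c d e f)"
  using assms unfolding splits_def by blast

lemma qeval_linear_factors:
  fixes R :: "'a ring" (structure)
  assumes "cring R" and "{l1, l2, l3, m1, m2, m3, x, y, z} \<subseteq> carrier R"
  shows "qeval R (QForm (l1 \<otimes> m1) (l2 \<otimes> m2) (l3 \<otimes> m3) (l2 \<otimes> m3 \<oplus> l3 \<otimes> m2)
      (l1 \<otimes> m3 \<oplus> l3 \<otimes> m1) (l1 \<otimes> m2 \<oplus> l2 \<otimes> m1)) (x, y, z)
    = (l1 \<otimes> x \<oplus> l2 \<otimes> y \<oplus> l3 \<otimes> z) \<otimes> (m1 \<otimes> x \<oplus> m2 \<otimes> y \<oplus> m3 \<otimes> z)"
proof -
  interpret cring R by fact
  show ?thesis using assms(2) by simp algebra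
qed

context domain
begin

lemma poly_ring_domain: "domain (poly_ring R)"
  by (rule univ_poly_is_domain[OF carrier_is_subring])

text \<open>Evaluation at the origin kills the linear forms, so these are not units.\<close>

lemma eval_zero_hom: "(\<lambda>p. eval p \<zero>) \<in> ring_hom (poly_ring R) R"
  using eval_cring_hom[OF carrier_is_subring zero_closed]
  unfolding ring_hom_cring_def ring_hom_cring_axioms_def by blast

lemma poly_of_const_hom: "poly_of_const \<in> ring_hom R (poly_ring R)"
  using canonical_embedding_is_hom[OF carrier_is_subring] by simp

lemma eval_zero_const: "c \<in> carrier R \<Longrightarrow> eval (poly_of_const c) \<zero> = c"
  by (simp add: poly_of_const_def)

lemma eval_zero_var: "eval X \<zero> = \<zero>"
  by (rule eval_var) simp

lemma X_closed: "X \<in> carrier (poly_ring R)"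
  by (rule var_closed[OF carrier_is_subring])

lemma eval_zero_zero: "eval \<zero>\<^bsub>poly_ring R\<^esub> \<zero> = \<zero>"
  by (simp add: univ_poly_zero)

end

lemma (in ring) hom_Units:
  assumes h: "h \<in> ring_hom S R" and u: "u \<in> Units S"
  shows "h u \<in> Units R"
  using u ring_hom_memE(1,2,4)[OF h] unfolding Units_def by (auto 0 3) (metis)

lemma qpoly_reducible:
  fixes R :: "'a ring" (structure)
  assumes "domain R" and "splits R Q"
  shows "\<not> ring_irreducible\<^bsub>poly_ring3 R\<^esub> (qpoly R Q)"
proof
  assume irr: "ring_irreducible\<^bsub>poly_ring3 R\<^esub> (qpoly R Q)"
  interpret domain R by fact
  interpret A1: domain "poly_ring R" by (rule poly_ring_domain)
  interpret A2: domain "poly_ring2 R" by (rule A1.poly_ring_domain)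
  interpret A3: domain "poly_ring3 R" by (rule A2.poly_ring_domain)
  obtain l1 l2 l3 m1 m2 m3 where lm: "{l1, l2, l3, m1, m2, m3} \<subseteq> carrier R"
    and Q: "Q = QForm (l1 \<otimes> m1) (l2 \<otimes> m2) (l3 \<otimes> m3) (l2 \<otimes> m3 \<oplus> l3 \<otimes> m2)
      (l1 \<otimes> m3 \<oplus> l3 \<otimes> m1) (l1 \<otimes> m2 \<oplus> l2 \<otimes> m1)"
    using assms(2) unfolding splits_def by blast
  have cdef: "const3 R = A2.poly_of_const \<circ> (A1.poly_of_const \<circ> poly_of_const)"
    by (simp add: const3_def fun_eq_iff)
  have chom: "const3 R \<in> ring_hom R (poly_ring3 R)"
    unfolding cdef
    by (intro ring_hom_trans[OF ring_hom_trans[OF poly_of_const_hom A1.poly_of_const_hom] A2.poly_of_const_hom])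
  \<comment> \<open>Evaluation at the origin, one variable at a time from Z down to X.\<close>
  define ev where "ev p = eval (A1.eval (A2.eval p \<zero>\<^bsub>poly_ring2 R\<^esub>) \<zero>\<^bsub>poly_ring R\<^esub>) \<zero>" for p
  have "ev = (\<lambda>p. eval p \<zero>) \<circ> ((\<lambda>p. A1.eval p \<zero>\<^bsub>poly_ring R\<^esub>) \<circ> (\<lambda>p. A2.eval p \<zero>\<^bsub>poly_ring2 R\<^esub>))"
    by (simp add: ev_def fun_eq_iff)
  then have ev: "ev \<in> ring_hom (poly_ring3 R) R"
    by (simp only:) (intro ring_hom_trans[OF ring_hom_trans[OF A2.eval_zero_hom A1.eval_zero_hom] eval_zero_hom])
  obtain x y z where xyz: "vars3 R = (x, y, z)" by (cases "vars3 R")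
  note pc = ring_hom_memE(1)[OF A1.poly_of_const_hom] ring_hom_memE(1)[OF A2.poly_of_const_hom]
  from xyz have x: "x = A2.poly_of_const (A1.poly_of_const X)"
    and y: "y = A2.poly_of_const X\<^bsub>poly_ring R\<^esub>" and z: "z = X\<^bsub>poly_ring2 R\<^esub>"
    by (auto simp: vars3_def)
  have xyz_closed: "x \<in> carrier (poly_ring3 R)" "y \<in> carrier (poly_ring3 R)" "z \<in> carrier (poly_ring3 R)"
    by (auto simp: x y z pc X_closed A1.X_closed A2.X_closed)
  have ev_xyz: "ev x = \<zero>" "ev y = \<zero>" "ev z = \<zero>"
    by (simp_all add: ev_def x y z pc X_closed A1.X_closed A2.X_closed A1.eval_zero_const A2.eval_zero_const
        eval_zero_var A1.eval_zero_var A2.eval_zero_var eval_zero_zero A1.eval_zero_zero)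
  define lin where "lin l1 l2 l3 = const3 R l1 \<otimes>\<^bsub>poly_ring3 R\<^esub> x \<oplus>\<^bsub>poly_ring3 R\<^esub> const3 R l2 \<otimes>\<^bsub>poly_ring3 R\<^esub> y
      \<oplus>\<^bsub>poly_ring3 R\<^esub> const3 R l3 \<otimes>\<^bsub>poly_ring3 R\<^esub> z" for l1 l2 l3
  note cc = ring_hom_memE(1)[OF chom]
  have lin: "lin l1 l2 l3 \<in> carrier (poly_ring3 R)" "lin l1 l2 l3 \<notin> Units (poly_ring3 R)"
    if "{l1, l2, l3} \<subseteq> carrier R" for l1 l2 l3
  proof -
    show "lin l1 l2 l3 \<in> carrier (poly_ring3 R)"
      using that xyz_closed by (simp add: lin_def cc)
    have "ev (lin l1 l2 l3) = \<zero>"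
      using that xyz_closed ring_hom_memE(1)[OF ev]
      by (simp add: lin_def cc ring_hom_memE(2,3)[OF ev] ev_xyz)
    then show "lin l1 l2 l3 \<notin> Units (poly_ring3 R)"
      using hom_Units[OF ev, of "lin l1 l2 l3"] zero_not_one by (auto simp: Units_def)
  qed
  have "qpoly R Q = lin l1 l2 l3 \<otimes>\<^bsub>poly_ring3 R\<^esub> lin m1 m2 m3"
    using lm xyz_closed qeval_linear_factors[OF A3.is_cring, of "const3 R l1" "const3 R l2" "const3 R l3" "const3 R m1" "const3 R m2" "const3 R m3" x y z]
    by (simp add: qpoly_def Q xyz lin_def cc ring_hom_memE(2,3)[OF chom] del: qeval.simps)
  moreover have "qpoly R Q \<in> carrier (poly_ring3 R)"
    using calculation lin lm by simp
  ultimately show False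
    using A3.ring_irreducibleE(5)[OF _ irr, of "lin l1 l2 l3" "lin m1 m2 m3"] lin lm by auto
qed

text \<open>With r a root of a T^2 + f T + b, the form a X^2 + f X Y + b Y^2 is (X - r Y)(a X + (f +
  a r) Y). If a = 0, the factor Y splits off.\<close>

lemma (in algebraically_closed) binary_form_splits:
  assumes "a \<in> carrier L" "b \<in> carrier L" "f \<in> carrier L"
  obtains \<alpha> \<beta> \<gamma> \<delta> where "\<alpha> \<in> carrier L" "\<beta> \<in> carrier L" "\<gamma> \<in> carrier L" "\<delta> \<in> carrier L"
    "a = \<alpha> \<otimes> \<gamma>" "b = \<beta> \<otimes> \<delta>" "f = \<alpha> \<otimes> \<delta> \<oplus> \<beta> \<otimes> \<gamma>"
proof (cases "a = \<zero>")
  case True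
  show ?thesis by (rule that[of \<zero> \<one> f b]) (use assms True in simp_all)
next
  case False
  let ?p = "[a, f, b]"
  have p: "?p \<in> carrier (poly_ring L)"
    using assms False by (simp add: univ_poly_carrier[symmetric] polynomial_def)
  have "splitted ?p" by (rule roots_over_carrier[OF p])
  then have "size (roots ?p) = 2" by (simp add: splitted_def)
  then obtain r where "r \<in># roots ?p" by (metis multiset_nonemptyE size_empty zero_neq_numeral)
  then have "is_root ?p r" using roots_mem_iff_is_root[OF p] by simp
  then have r: "r \<in> carrier L" "a \<otimes> (r \<otimes> r) \<oplus> (f \<otimes> r \<oplus> b) = \<zero>"
    using assms by (auto simp: is_root_def numeral_2_eq_2 m_assoc a_assoc)
  have "b = \<ominus> r \<otimes> (f \<oplus> a \<otimes> r)"
  proof -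
    have "b = (a \<otimes> (r \<otimes> r) \<oplus> (f \<otimes> r \<oplus> b)) \<oplus> \<ominus> r \<otimes> (f \<oplus> a \<otimes> r)"
      using assms r(1) by algebra
    then show ?thesis using r assms by simp
  qed
  moreover have "f = \<one> \<otimes> (f \<oplus> a \<otimes> r) \<oplus> \<ominus> r \<otimes> a"
    using assms r(1) by algebra
  ultimately show ?thesis
    by (intro that[of \<one> "\<ominus> r" a "f \<oplus> a \<otimes> r"]) (use assms r(1) in simp_all)
qed

text \<open>In coordinates centred at the singular point the form depends on two variables only:
  with the point scaled to (x', y', 1), it is a U^2 + f U V + b V^2 at U = X - x' Z and V = Y - y'
  Z, and a binary form splits.\<close>

lemma splits_if_singular_aux:
  fixes L :: "'a ring" (structure)
  assumes "algebraically_closed L" and char: "\<one> \<oplus> \<one> \<noteq> \<zero>"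
    and Q: "Q \<in> qforms L" and w: "{x, y, z} \<subseteq> carrier L" "z \<noteq> \<zero>"
    and grad: "qgrad L Q (x, y, z) = (\<zero>, \<zero>, \<zero>)"
  shows "splits L Q"
proof -
  interpret algebraically_closed L by fact
  obtain a b c d e f where Q_eq: "Q = QForm a b c d e f" by (cases Q)
  have cl: "a \<in> carrier L" "b \<in> carrier L" "c \<in> carrier L" "d \<in> carrier L" "e \<in> carrier L" "f \<in> carrier L"
    using Q by (auto simp: qforms_def Q_eq)
  define k where "k = inv z"
  have k: "k \<in> carrier L" "z \<otimes> k = \<one>"
    using w by (auto simp: k_def field_Units intro!: Units_r_inv)
  define x' y' where "x' = k \<otimes> x" and "y' = k \<otimes> y"
  have xy: "x' \<in> carrier L" "y' \<in> carrier L" using w k by (auto simp: x'_def y'_def)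
  from grad have g: "(a \<otimes> x \<oplus> a \<otimes> x) \<oplus> e \<otimes> z \<oplus> f \<otimes> y = \<zero>"
      "(b \<otimes> y \<oplus> b \<otimes> y) \<oplus> d \<otimes> z \<oplus> f \<otimes> x = \<zero>"
      "(c \<otimes> z \<oplus> c \<otimes> z) \<oplus> d \<otimes> y \<oplus> e \<otimes> x = \<zero>"
    by (simp_all add: Q_eq)
  have e: "e = \<ominus> (a \<otimes> x' \<oplus> a \<otimes> x' \<oplus> f \<otimes> y')"
  proof -
    have "e \<otimes> (z \<otimes> k) = k \<otimes> ((a \<otimes> x \<oplus> a \<otimes> x) \<oplus> e \<otimes> z \<oplus> f \<otimes> y) \<ominus> (a \<otimes> x' \<oplus> a \<otimes> x' \<oplus> f \<otimes> y')"
      using w k(1) cl unfolding x'_def y'_def by simp algebra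
    then show ?thesis using k cl xy g by (simp add: minus_eq)
  qed
  have d: "d = \<ominus> (b \<otimes> y' \<oplus> b \<otimes> y' \<oplus> f \<otimes> x')"
  proof -
    have "d \<otimes> (z \<otimes> k) = k \<otimes> ((b \<otimes> y \<oplus> b \<otimes> y) \<oplus> d \<otimes> z \<oplus> f \<otimes> x) \<ominus> (b \<otimes> y' \<oplus> b \<otimes> y' \<oplus> f \<otimes> x')"
      using w k(1) cl unfolding x'_def y'_def by simp algebra
    then show ?thesis using k cl xy g by (simp add: minus_eq)
  qed
  have c2: "c \<oplus> c = \<ominus> (d \<otimes> y' \<oplus> e \<otimes> x')"
  proof -
    have "(c \<oplus> c) \<otimes> (z \<otimes> k) = k \<otimes> ((c \<otimes> z \<oplus> c \<otimes> z) \<oplus> d \<otimes> y \<oplus> e \<otimes> x) \<ominus> (d \<otimes> y' \<oplus> e \<otimes> x')"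
      using w k(1) cl unfolding x'_def y'_def by simp algebra
    then show ?thesis using k cl xy g by (simp add: minus_eq)
  qed
  let ?c = "a \<otimes> (x' \<otimes> x') \<oplus> f \<otimes> (x' \<otimes> y') \<oplus> b \<otimes> (y' \<otimes> y')"
  \<comment> \<open>The third gradient equation determines only c + c, so 2 has to be
    cancelled.\<close>
  have c: "c = ?c"
  proof -
    have "(\<one> \<oplus> \<one>) \<otimes> (c \<ominus> ?c) = (c \<oplus> c) \<ominus> (?c \<oplus> ?c)"
      using cl xy by algebra
    also have "\<dots> = \<ominus> (\<ominus> (b \<otimes> y' \<oplus> b \<otimes> y' \<oplus> f \<otimes> x') \<otimes> y' \<oplus> \<ominus> (a \<otimes> x' \<oplus> a \<otimes> x' \<oplus> f \<otimes> y') \<otimes> x') \<ominus> (?c \<oplus> ?c)"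
      unfolding c2 using d e by argo
    also have "\<dots> = \<zero>" using cl(1,2,6) xy by algebra
    finally have "c \<ominus> ?c = \<zero>"
      using char cl xy by (metis (no_types, lifting) integral minus_closed add.m_closed one_closed m_closed)
    then show ?thesis using cl xy by simp
  qed
  obtain \<alpha> \<beta> \<gamma> \<delta> where gr: "\<alpha> \<in> carrier L" "\<beta> \<in> carrier L" "\<gamma> \<in> carrier L" "\<delta> \<in> carrier L"
    and abf: "a = \<alpha> \<otimes> \<gamma>" "b = \<beta> \<otimes> \<delta>" "f = \<alpha> \<otimes> \<delta> \<oplus> \<beta> \<otimes> \<gamma>"
    using binary_form_splits[OF cl(1,2,6)] .
  let ?l3 = "\<ominus> (\<alpha> \<otimes> x' \<oplus> \<beta> \<otimes> y')" and ?m3 = "\<ominus> (\<gamma> \<otimes> x' \<oplus> \<delta> \<otimes> y')"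
  have "c = ?l3 \<otimes> ?m3" unfolding c abf using gr xy by algebra
  moreover have "d = \<beta> \<otimes> ?m3 \<oplus> ?l3 \<otimes> \<delta>" unfolding d abf using gr xy by algebra
  moreover have "e = \<alpha> \<otimes> ?m3 \<oplus> ?l3 \<otimes> \<gamma>" unfolding e abf using gr xy by algebra
  moreover have "f = \<alpha> \<otimes> \<delta> \<oplus> \<beta> \<otimes> \<gamma>" by (rule abf)
  ultimately show ?thesis
    unfolding Q_eq using abf gr xy
    by (intro splitsI[of \<alpha> _ \<beta> ?l3 \<gamma> \<delta> ?m3]) simp_all
qed

lemma splits_rotate:
  fixes R :: "'a ring" (structure)
  assumes "cring R" "splits R (rotate_form Q)"
  shows "splits R Q"
proof -
  interpret cring R by fact
  obtain a b c d e f where Q: "Q = QForm a b c d e f" by (cases Q)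
  obtain l1 l2 l3 m1 m2 m3 where lm: "{l1, l2, l3, m1, m2, m3} \<subseteq> carrier R"
    and "b = l1 \<otimes> m1" "c = l2 \<otimes> m2" "a = l3 \<otimes> m3" "e = l2 \<otimes> m3 \<oplus> l3 \<otimes> m2"
      "f = l1 \<otimes> m3 \<oplus> l3 \<otimes> m1" "d = l1 \<otimes> m2 \<oplus> l2 \<otimes> m1"
    using assms(2) unfolding splits_def by (auto simp: Q)
  then show ?thesis
    unfolding Q
    by (intro splitsI[of l3 _ l1 l2 m3 m1 m2]) (simp_all add: a_comm[of "l2 \<otimes> m3"] a_comm[of "l1 \<otimes> m3"])
qed

lemma qgrad_rotate:
  fixes R :: "'a ring" (structure)
  assumes "cring R" "Q \<in> qforms R" "v \<in> carrier R \<times> carrier R \<times> carrier R"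
  shows "qgrad R (rotate_form Q) (rotate_vec v) = rotate_vec (qgrad R Q v)"
proof -
  interpret cring R by fact
  show ?thesis
    using assms(2,3) by (cases Q; cases v) (auto simp: qforms_def a_ac)
qed

lemma splits_if_singular:
  fixes L :: "'a ring" (structure)
  assumes L: "algebraically_closed L" and char: "\<one> \<oplus> \<one> \<noteq> \<zero>"
    and Q: "Q \<in> qforms L" and w: "w \<in> nonzero_vecs L" and grad: "qgrad L Q w = (\<zero>, \<zero>, \<zero>)"
  shows "splits L Q"
proof -
  interpret algebraically_closed L by fact
  obtain x y z where xyz: "w = (x, y, z)" by (cases w)
  have cl: "x \<in> carrier L" "y \<in> carrier L" "z \<in> carrier L"
    and nz: "x \<noteq> \<zero> \<or> y \<noteq> \<zero> \<or> z \<noteq> \<zero>" using w by (auto simp: nonzero_vecs_def xyz)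
  have rot: "rotate_form Q' \<in> qforms L" if "Q' \<in> qforms L" for Q'
    using that by (cases Q') (auto simp: qforms_def)
  have g1: "qgrad L (rotate_form Q) (y, z, x) = (\<zero>, \<zero>, \<zero>)"
    using qgrad_rotate[OF is_cring Q, of "(x, y, z)"] cl grad by (simp add: xyz)
  have g2: "qgrad L (rotate_form (rotate_form Q)) (z, x, y) = (\<zero>, \<zero>, \<zero>)"
    using qgrad_rotate[OF is_cring rot[OF Q], of "(y, z, x)"] cl g1 by simp
  from nz consider "z \<noteq> \<zero>" | "x \<noteq> \<zero>" | "y \<noteq> \<zero>" by blast
  then show ?thesis
  proof cases
    case 1 then show ?thesis
      using splits_if_singular_aux[OF L char Q, of x y z] cl grad xyz by simp
  next
    case 2 then show ?thesis
      using splits_if_singular_aux[OF L char rot[OF Q] _ _ g1] cl splits_rotate[OF is_cring] by simp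
  next
    case 3 then show ?thesis
      using splits_if_singular_aux[OF L char rot[OF rot[OF Q]] _ _ g2] cl splits_rotate[OF is_cring] by simp
  qed
qed

section \<open>Singular forms over an algebraically closed field, tangent lines over the base field\<close>

text \<open>Demanded at all nonzero vectors, so that the linear map \<open>qgrad\<close> has trivial
  kernel. In odd characteristic Euler's identity places every zero of the gradient on the
  conic.\<close>

definition nonsingular :: "'a ring \<Rightarrow> 'a qform \<Rightarrow> bool" where
  "nonsingular R Q \<longleftrightarrow> (\<forall>w \<in> nonzero_vecs R. qgrad R Q w \<noteq> (\<zero>\<^bsub>R\<^esub>, \<zero>\<^bsub>R\<^esub>, \<zero>\<^bsub>R\<^esub>))"

abbreviation map_vec :: "('a \<Rightarrow> 'b) \<Rightarrow> 'a \<times> 'a \<times> 'a \<Rightarrow> 'b \<times> 'b \<times> 'b" where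
  "map_vec h \<equiv> map_prod h (map_prod h h)"

abbreviation vecs :: "'a ring \<Rightarrow> ('a \<times> 'a \<times> 'a) set" where
  "vecs R \<equiv> carrier R \<times> carrier R \<times> carrier R"

section \<open>Compatibility with ring homomorphisms, odd characteristic and scaling\<close>

lemma hom_qeval:
  assumes "h \<in> ring_hom R S" "ring R" "Q \<in> qforms R" "v \<in> vecs R"
  shows "qeval S (map_qform h Q) (map_vec h v) = h (qeval R Q v)"
proof -
  interpret ring R by fact
  obtain a b c d e f where Q: "Q = QForm a b c d e f" by (cases Q)
  obtain x y z where v: "v = (x, y, z)" by (cases v)
  have cl: "a \<in> carrier R" "b \<in> carrier R" "c \<in> carrier R" "d \<in> carrier R" "e \<in> carrier R" "f \<in> carrier R"
    "x \<in> carrier R" "y \<in> carrier R" "z \<in> carrier R"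
    using assms(3,4) by (auto simp: qforms_def Q v)
  show ?thesis
    by (simp add: Q v cl ring_hom_memE(2,3)[OF assms(1)])
qed

lemma hom_qgrad:
  assumes "h \<in> ring_hom R S" "ring R" "Q \<in> qforms R" "v \<in> vecs R"
  shows "qgrad S (map_qform h Q) (map_vec h v) = map_vec h (qgrad R Q v)"
proof -
  interpret ring R by fact
  obtain a b c d e f where Q: "Q = QForm a b c d e f" by (cases Q)
  obtain x y z where v: "v = (x, y, z)" by (cases v)
  have cl: "a \<in> carrier R" "b \<in> carrier R" "c \<in> carrier R" "d \<in> carrier R" "e \<in> carrier R" "f \<in> carrier R"
    "x \<in> carrier R" "y \<in> carrier R" "z \<in> carrier R"
    using assms(3,4) by (auto simp: qforms_def Q v)
  show ?thesis
    by (simp add: Q v cl ring_hom_memE(2,3)[OF assms(1)])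
qed

text \<open>Otherwise {0, 1} would be an additive subgroup of order 2, against Lagrange's
  theorem.\<close>

lemma (in field) one_plus_one_neq_zero:
  assumes "finite (carrier R)" "odd (order R)"
  shows "\<one> \<oplus> \<one> \<noteq> \<zero>"
proof
  assume two: "\<one> \<oplus> \<one> = \<zero>"
  have "subgroup {\<zero>, \<one>} (add_monoid R)"
    by (rule group.subgroupI[OF a_group])
       (auto simp: two minus_equality a_inv_def[symmetric])
  then have "card (rcosets\<^bsub>add_monoid R\<^esub> {\<zero>, \<one>}) * card {\<zero>, \<one>} = Coset.order (add_monoid R)"
    by (rule group.lagrange[OF a_group])
  moreover have "card {\<zero>, \<one>} = 2" using zero_not_one by simp
  moreover have "Coset.order (add_monoid R) = order R" by (simp add: order_def)
  ultimately have "even (order R)" by (metis dvd_triv_right)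
  with assms show False by simp
qed

context cring
begin

lemma grad_component_diff:
  assumes "a \<in> carrier R" "e \<in> carrier R" "f \<in> carrier R" "x \<in> carrier R" "y \<in> carrier R" "z \<in> carrier R"
    "x' \<in> carrier R" "y' \<in> carrier R" "z' \<in> carrier R"
  shows "(a \<otimes> (x \<ominus> x') \<oplus> a \<otimes> (x \<ominus> x')) \<oplus> e \<otimes> (z \<ominus> z') \<oplus> f \<otimes> (y \<ominus> y')
    = ((a \<otimes> x \<oplus> a \<otimes> x) \<oplus> e \<otimes> z \<oplus> f \<otimes> y) \<ominus> ((a \<otimes> x' \<oplus> a \<otimes> x') \<oplus> e \<otimes> z' \<oplus> f \<otimes> y')"
  using assms by algebra

lemma grad_component_scale:
  assumes "k \<in> carrier R" "a \<in> carrier R" "e \<in> carrier R" "f \<in> carrier R"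
    "x \<in> carrier R" "y \<in> carrier R" "z \<in> carrier R"
  shows "(a \<otimes> (k \<otimes> x) \<oplus> a \<otimes> (k \<otimes> x)) \<oplus> e \<otimes> (k \<otimes> z) \<oplus> f \<otimes> (k \<otimes> y)
    = k \<otimes> ((a \<otimes> x \<oplus> a \<otimes> x) \<oplus> e \<otimes> z \<oplus> f \<otimes> y)"
  using assms by algebra

lemma monomial_scale:
  assumes "k \<in> carrier R" "a \<in> carrier R" "x \<in> carrier R" "y \<in> carrier R"
  shows "a \<otimes> ((k \<otimes> x) \<otimes> (k \<otimes> y)) = k \<otimes> k \<otimes> (a \<otimes> (x \<otimes> y))"
  using assms by algebra

lemma lin_scale:
  assumes "k \<in> carrier R" "l \<in> carrier R" "m \<in> carrier R" "n \<in> carrier R"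
    "x \<in> carrier R" "y \<in> carrier R" "z \<in> carrier R"
  shows "(k \<otimes> l) \<otimes> x \<oplus> (k \<otimes> m) \<otimes> y \<oplus> (k \<otimes> n) \<otimes> z = k \<otimes> (l \<otimes> x \<oplus> m \<otimes> y \<oplus> n \<otimes> z)"
    "l \<otimes> (k \<otimes> x) \<oplus> m \<otimes> (k \<otimes> y) \<oplus> n \<otimes> (k \<otimes> z) = k \<otimes> (l \<otimes> x \<oplus> m \<otimes> y \<oplus> n \<otimes> z)"
  using assms by algebra+

end

section \<open>Projective points and lines as orbits of scaling\<close>

locale plane = field F for F :: "'a ring" (structure)
begin

definition scale :: "'a \<Rightarrow> 'a \<times> 'a \<times> 'a \<Rightarrow> 'a \<times> 'a \<times> 'a" where
  "scale k v = map_vec ((\<otimes>) k) v"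

lemma scale_simp [simp]: "scale k (x, y, z) = (k \<otimes> x, k \<otimes> y, k \<otimes> z)"
  by (simp add: scale_def)

lemma scale_closed [simp]: "k \<in> carrier F \<Longrightarrow> v \<in> vecs F \<Longrightarrow> scale k v \<in> vecs F"
  by (cases v) auto

lemma nonzero_vecs_D: "v \<in> nonzero_vecs F \<Longrightarrow> v \<in> vecs F"
  by (simp add: nonzero_vecs_def)

lemma scale_one [simp]: "v \<in> vecs F \<Longrightarrow> scale \<one> v = v"
  by (cases v) auto

lemma scale_scale: "k \<in> carrier F \<Longrightarrow> k' \<in> carrier F \<Longrightarrow> v \<in> vecs F \<Longrightarrow> scale k (scale k' v) = scale (k \<otimes> k') v"
  by (cases v) (auto simp: m_assoc)

lemma inv_nz: "k \<in> carrier F \<Longrightarrow> k \<noteq> \<zero> \<Longrightarrow> inv k \<in> carrier F \<and> inv k \<noteq> \<zero> \<and> inv k \<otimes> k = \<one>"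
  using field_Units Units_l_inv[of k] Units_inv_closed[of k] Units_inv_Units[of k] by auto

lemma scale_nonzero [simp]:
  assumes "k \<in> carrier F" "k \<noteq> \<zero>" "v \<in> nonzero_vecs F"
  shows "scale k v \<in> nonzero_vecs F"
proof -
  obtain x y z where v: "v = (x, y, z)" by (cases v)
  have "k \<otimes> x = \<zero> \<longleftrightarrow> x = \<zero>" "k \<otimes> y = \<zero> \<longleftrightarrow> y = \<zero>" "k \<otimes> z = \<zero> \<longleftrightarrow> z = \<zero>"
    using assms by (auto simp: nonzero_vecs_def v integral_iff)
  then show ?thesis using assms by (auto simp: nonzero_vecs_def v)
qed

lemma proj_rel_iff:
  "(u, v) \<in> proj_rel F \<longleftrightarrow> u \<in> nonzero_vecs F \<and> (\<exists>k \<in> carrier F - {\<zero>}. v = scale k u)"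
proof -
  have "(case u of (x, y, z) \<Rightarrow> (k \<otimes> x, k \<otimes> y, k \<otimes> z)) = scale k u" for k
    by (cases u) simp
  then show ?thesis by (auto simp: proj_rel_def)
qed

lemma equiv_proj_rel: "equiv (nonzero_vecs F) (proj_rel F)"
proof (rule equivI)
  show "proj_rel F \<subseteq> nonzero_vecs F \<times> nonzero_vecs F" by (auto simp: proj_rel_def)
  show "refl_on (nonzero_vecs F) (proj_rel F)"
    by (auto simp: refl_on_def proj_rel_iff intro!: bexI[of _ \<one>] dest: nonzero_vecs_D)
  show "sym (proj_rel F)"
  proof (rule symI)
    fix u v assume "(u, v) \<in> proj_rel F"
    then obtain k where k: "k \<in> carrier F" "k \<noteq> \<zero>" "v = scale k u" "u \<in> nonzero_vecs F"
      by (auto simp: proj_rel_iff)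
    then have "u = scale (inv k) v" "v \<in> nonzero_vecs F"
      using inv_nz[OF k(1,2)] by (simp_all add: scale_scale nonzero_vecs_D)
    then show "(v, u) \<in> proj_rel F" using inv_nz[OF k(1,2)] by (auto simp: proj_rel_iff)
  qed
  show "trans (proj_rel F)"
  proof (rule transI)
    fix u v w assume "(u, v) \<in> proj_rel F" "(v, w) \<in> proj_rel F"
    then obtain k k' where "k \<in> carrier F" "k \<noteq> \<zero>" "v = scale k u" "u \<in> nonzero_vecs F"
        "k' \<in> carrier F" "k' \<noteq> \<zero>" "w = scale k' v"
      by (auto simp: proj_rel_iff)
    then show "(u, w) \<in> proj_rel F"
      by (auto simp: proj_rel_iff scale_scale nonzero_vecs_D integral_iff intro!: bexI[of _ "k' \<otimes> k"])
  qed
qed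

lemma class_eq:
  assumes "c \<in> nonzero_vecs F // proj_rel F" "v \<in> c"
  shows "c = (\<lambda>k. scale k v) ` (carrier F - {\<zero>})" "v \<in> nonzero_vecs F"
proof -
  show v: "v \<in> nonzero_vecs F"
    using assms equiv_proj_rel by (metis in_quotient_imp_subset subsetD)
  have "c = proj_rel F `` {v}"
    using assms equiv_proj_rel by (metis Image_singleton_iff equiv_class_eq quotientE)
  then show "c = (\<lambda>k. scale k v) ` (carrier F - {\<zero>})"
    using v by (auto simp: proj_rel_iff)
qed

lemma scale_cancel:
  assumes "v \<in> nonzero_vecs F" "k \<in> carrier F" "k' \<in> carrier F" "scale k v = scale k' v"
  shows "k = k'"
  using assms by (cases v) (auto simp: nonzero_vecs_def m_rcancel)

definition scaling_closed :: "('a \<times> 'a \<times> 'a) set \<Rightarrow> bool" where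
  "scaling_closed S \<longleftrightarrow> S \<subseteq> nonzero_vecs F \<and> (\<forall>v\<in>S. \<forall>k\<in>carrier F - {\<zero>}. scale k v \<in> S)"

lemma class_subset_iff:
  assumes "scaling_closed S" "c \<in> nonzero_vecs F // proj_rel F" "v \<in> c"
  shows "c \<subseteq> S \<longleftrightarrow> v \<in> S"
  using assms class_eq(1)[OF assms(2,3)] unfolding scaling_closed_def by auto

text \<open>Such a set is a disjoint union of projective classes, and nonzero scalars act freely on
  nonzero vectors, so each class has q - 1 elements.\<close>

lemma card_scaling_closed:
  assumes fin: "finite (carrier F)" and S: "scaling_closed S"
  shows "card S = (order F - 1) * card {c \<in> nonzero_vecs F // proj_rel F. c \<subseteq> S}"
proof -
  let ?C = "{c \<in> nonzero_vecs F // proj_rel F. c \<subseteq> S}"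
  have finS: "finite S"
    using S fin by (auto simp: scaling_closed_def nonzero_vecs_def intro: finite_subset[of _ "vecs F"])
  have U: "\<Union>?C = S"
  proof
    show "S \<subseteq> \<Union>?C"
    proof
      fix v assume v: "v \<in> S"
      then have nz: "v \<in> nonzero_vecs F" using S by (auto simp: scaling_closed_def)
      have c: "proj_rel F `` {v} \<in> nonzero_vecs F // proj_rel F" by (rule quotientI[OF nz])
      have in_c: "v \<in> proj_rel F `` {v}" using equiv_class_self[OF equiv_proj_rel nz] .
      show "v \<in> \<Union>?C" using class_subset_iff[OF S c in_c] c in_c v by blast
    qed
  qed auto
  have cc: "card c = order F - 1" if "c \<in> ?C" for c
  proof -
    from that have c: "c \<in> nonzero_vecs F // proj_rel F" by simp
    obtain v where v: "v \<in> c" using in_quotient_imp_non_empty[OF equiv_proj_rel c] by blast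
    have "card c = card (carrier F - {\<zero>})"
      unfolding class_eq(1)[OF c v]
      by (rule card_image) (auto simp: inj_on_def intro: scale_cancel[OF class_eq(2)[OF c v]])
    then show ?thesis by (simp add: order_def card_Diff_singleton)
  qed
  have "(order F - 1) * card ?C = card (\<Union>?C)"
  proof (rule card_partition)
    show "finite ?C" using U finS by (metis finite_UnionD)
    show "finite (\<Union>?C)" using U finS by simp
    show "c1 \<inter> c2 = {}" if "c1 \<in> ?C" "c2 \<in> ?C" "c1 \<noteq> c2" for c1 c2
      using that quotient_disj[OF equiv_proj_rel, of c1 c2] by blast
  qed (use cc in auto)
  then show ?thesis using U by simp
qed

lemma qeval_scale:
  assumes "Q \<in> qforms F" "k \<in> carrier F" "v \<in> vecs F"
  shows "qeval F Q (scale k v) = k \<otimes> k \<otimes> qeval F Q v"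
proof -
  obtain a b c d e f where Q: "Q = QForm a b c d e f" by (cases Q)
  obtain x y z where v: "v = (x, y, z)" by (cases v)
  have cl: "a \<in> carrier F" "b \<in> carrier F" "c \<in> carrier F" "d \<in> carrier F" "e \<in> carrier F" "f \<in> carrier F"
    "x \<in> carrier F" "y \<in> carrier F" "z \<in> carrier F"
    using assms by (auto simp: qforms_def Q v)
  show ?thesis
    using assms(2) cl by (simp add: Q v monomial_scale r_distr)
qed

lemma qgrad_scale:
  assumes "Q \<in> qforms F" "k \<in> carrier F" "v \<in> vecs F"
  shows "qgrad F Q (scale k v) = scale k (qgrad F Q v)"
proof -
  obtain a b c d e f where Q: "Q = QForm a b c d e f" by (cases Q)
  obtain x y z where v: "v = (x, y, z)" by (cases v)
  have cl: "a \<in> carrier F" "b \<in> carrier F" "c \<in> carrier F" "d \<in> carrier F" "e \<in> carrier F" "f \<in> carrier F"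
    "x \<in> carrier F" "y \<in> carrier F" "z \<in> carrier F"
    using assms by (auto simp: qforms_def Q v)
  show ?thesis
    using assms(2) cl by (simp add: Q v grad_component_scale)
qed

lemma lin_eval_scale:
  assumes "k \<in> carrier F" "l \<in> vecs F" "v \<in> vecs F"
  shows "lin_eval F (scale k l) v = k \<otimes> lin_eval F l v" "lin_eval F l (scale k v) = k \<otimes> lin_eval F l v"
  using assms by (cases l; cases v; simp add: lin_scale)+

lemma form_closed:
  assumes "Q \<in> qforms F" "v \<in> vecs F"
  shows "qeval F Q v \<in> carrier F" "qgrad F Q v \<in> vecs F"
  using assms by (cases Q; cases v; auto simp: qforms_def)+

lemma lin_eval_closed:
  assumes "l \<in> vecs F" "v \<in> vecs F"
  shows "lin_eval F l v \<in> carrier F"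
  using assms by (cases l; cases v; auto)

lemma inj_on_qgrad:
  assumes Q: "Q \<in> qforms F" and ns: "nonsingular F Q"
  shows "inj_on (qgrad F Q) (vecs F)"
proof (rule inj_onI)
  fix u v assume u: "u \<in> vecs F" and v: "v \<in> vecs F" and eq: "qgrad F Q u = qgrad F Q v"
  obtain x y z where u': "u = (x, y, z)" by (cases u)
  obtain x' y' z' where v': "v = (x', y', z')" by (cases v)
  obtain a b c d e f where Q': "Q = QForm a b c d e f" by (cases Q)
  let ?w = "(x \<ominus> x', y \<ominus> y', z \<ominus> z')"
  have cl: "{a, b, c, d, e, f, x, y, z, x', y', z'} \<subseteq> carrier F"
    using u v Q by (auto simp: u' v' Q' qforms_def)
  obtain p q r where pqr: "qgrad F Q u = (p, q, r)" by (cases "qgrad F Q u")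
  have pqr': "qgrad F Q v = (p, q, r)" using eq pqr by simp
  have pc: "{p, q, r} \<subseteq> carrier F" using form_closed(2)[OF Q u] pqr by auto
  have "qgrad F Q ?w = (p \<ominus> p, q \<ominus> q, r \<ominus> r)"
  proof -
    have *: "(a \<otimes> x \<oplus> a \<otimes> x) \<oplus> e \<otimes> z \<oplus> f \<otimes> y = p" "(b \<otimes> y \<oplus> b \<otimes> y) \<oplus> d \<otimes> z \<oplus> f \<otimes> x = q"
      "(c \<otimes> z \<oplus> c \<otimes> z) \<oplus> d \<otimes> y \<oplus> e \<otimes> x = r"
      "(a \<otimes> x' \<oplus> a \<otimes> x') \<oplus> e \<otimes> z' \<oplus> f \<otimes> y' = p" "(b \<otimes> y' \<oplus> b \<otimes> y') \<oplus> d \<otimes> z' \<oplus> f \<otimes> x' = q"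
      "(c \<otimes> z' \<oplus> c \<otimes> z') \<oplus> d \<otimes> y' \<oplus> e \<otimes> x' = r"
      using pqr pqr' unfolding u' v' Q' qgrad.simps prod.inject by blast+
    show ?thesis
      using cl unfolding Q' qgrad.simps prod.inject insert_subset
      by (simp only: grad_component_diff * simp_thms)
  qed
  then have "qgrad F Q ?w = (\<zero>, \<zero>, \<zero>)" using pc by simp
  then have "?w \<notin> nonzero_vecs F" using ns by (auto simp: nonsingular_def)
  then show "u = v" using cl by (auto simp: nonzero_vecs_def u' v')
qed

end

text \<open>The contact vectors of tangents through \<open>v\<close>, written with the gradient at
  \<open>w\<close> as in the definition of a tangent; reciprocity later turns them into
  \<open>polar_zeros\<close>.\<close>

definition polar_pts :: "'a ring \<Rightarrow> 'a qform \<Rightarrow> 'a \<times> 'a \<times> 'a \<Rightarrow> ('a \<times> 'a \<times> 'a) set" where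
  "polar_pts R Q v = {w \<in> nonzero_vecs R. qeval R Q w = \<zero>\<^bsub>R\<^esub> \<and> lin_eval R (qgrad R Q w) v = \<zero>\<^bsub>R\<^esub>}"

text \<open>Two tangents amount to two contact points, that is, to 2 (q - 1) contact
  vectors.\<close>

definition ext_int_vecs :: "'a ring \<Rightarrow> 'a qform \<Rightarrow> 'a qform \<Rightarrow> ('a \<times> 'a \<times> 'a) set" where
  "ext_int_vecs R C D = {v \<in> nonzero_vecs R.
     qeval R C v \<noteq> \<zero>\<^bsub>R\<^esub> \<and> card (polar_pts R C v) = 2 * (order R - 1) \<and>
     qeval R D v \<noteq> \<zero>\<^bsub>R\<^esub> \<and> polar_pts R D v = {}}"

lemma map_vec_nonzero:
  assumes "h \<in> ring_hom R S" "ring R" "ring S" "inj_on h (carrier R)" "v \<in> nonzero_vecs R"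
  shows "map_vec h v \<in> nonzero_vecs S"
proof -
  obtain x y z where v: "v = (x, y, z)" by (cases v)
  have "h u = \<zero>\<^bsub>S\<^esub> \<longleftrightarrow> u = \<zero>\<^bsub>R\<^esub>" if "u \<in> carrier R" for u
    using ring_hom_zero[OF assms(1-3)] inj_onD[OF assms(4)] that ring.ring_simprules(2)[OF assms(2)] by metis
  then show ?thesis
    using assms(5) ring_hom_memE(1)[OF assms(1)] by (auto simp: nonzero_vecs_def v)
qed

lemma algebraic_closure_imp_algebraically_closed:
  assumes "algebraic_closure L K"
  shows "algebraically_closed L"
proof -
  interpret algebraic_closure L K by fact
  show ?thesis by (rule algebraically_closed_axioms)
qed

section \<open>Descent of tangency from the algebraic closure to F\<close>

locale odd_plane = plane +
  assumes finite_carrier: "finite (carrier F)" and odd_order: "odd (order F)"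
begin

abbreviation K where "K \<equiv> alg_closure"
abbreviation \<iota> :: "'a \<Rightarrow> ('a list \<times> nat) multiset \<Rightarrow> 'a" where "\<iota> \<equiv> indexed_const"

lemma K_algebraically_closed: "algebraically_closed K"
  by (rule algebraic_closure_imp_algebraically_closed[OF alg_closureE(1)])

lemma K_field: "field K"
  using K_algebraically_closed by (rule algebraically_closed.axioms)

lemma K_ring: "ring K"
  using K_field by (simp add: field_def domain_def cring_def)

lemma \<iota>_hom: "\<iota> \<in> ring_hom F K"
  by (rule alg_closureE(2))

lemma \<iota>_zero: "\<iota> \<zero> = \<zero>\<^bsub>K\<^esub>"
  by (rule ring_hom_zero[OF \<iota>_hom is_ring K_ring])

lemma \<iota>_eq: "\<iota> x = \<iota> y \<longleftrightarrow> x = y"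
  by (rule inj_eq[OF indexed_const_is_inj])

lemma map_\<iota>_nonzero: "v \<in> nonzero_vecs F \<Longrightarrow> map_vec \<iota> v \<in> nonzero_vecs K"
  by (rule map_vec_nonzero[OF \<iota>_hom is_ring K_ring indexed_const_inj_on])

lemma base_change_closed: "Q \<in> qforms F \<Longrightarrow> qbase_change F Q \<in> qforms K"
  using ring_hom_memE(1)[OF \<iota>_hom] by (auto simp: qforms_def qbase_change_def qform.set_map)

text \<open>A singular form is a product of linear forms over the closure, though not always over F,
  where it may be a pair of conjugate lines. A singular vector over F stays singular and nonzero
  under the embedding.\<close>

lemma geom_irreducible_nonsingular:
  assumes Q: "Q \<in> qforms F" and irr: "geom_irreducible F Q"
  shows "nonsingular K (qbase_change F Q)" "nonsingular F Q"
proof -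
  have "\<one>\<^bsub>K\<^esub> \<oplus>\<^bsub>K\<^esub> \<one>\<^bsub>K\<^esub> = \<iota> (\<one> \<oplus> \<one>)"
    by (simp add: ring_hom_memE(3,4)[OF \<iota>_hom])
  then have two: "\<one>\<^bsub>K\<^esub> \<oplus>\<^bsub>K\<^esub> \<one>\<^bsub>K\<^esub> \<noteq> \<zero>\<^bsub>K\<^esub>"
    using one_plus_one_neq_zero[OF finite_carrier odd_order] by (metis \<iota>_eq \<iota>_zero)
  have dom: "domain K" using K_field by (simp add: field_def)
  show K: "nonsingular K (qbase_change F Q)"
    unfolding nonsingular_def
  proof (intro ballI notI)
    fix w assume "w \<in> nonzero_vecs K" "qgrad K (qbase_change F Q) w = (\<zero>\<^bsub>K\<^esub>, \<zero>\<^bsub>K\<^esub>, \<zero>\<^bsub>K\<^esub>)"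
    then have "splits K (qbase_change F Q)"
      using splits_if_singular[OF K_algebraically_closed two base_change_closed[OF Q]] by blast
    then show False
      using qpoly_reducible[OF dom] irr by (simp add: geom_irreducible_def)
  qed
  show "nonsingular F Q"
    unfolding nonsingular_def
  proof (intro ballI notI)
    fix w assume w: "w \<in> nonzero_vecs F" and g: "qgrad F Q w = (\<zero>, \<zero>, \<zero>)"
    have "qgrad K (qbase_change F Q) (map_vec \<iota> w) = map_vec \<iota> (qgrad F Q w)"
      unfolding qbase_change_def by (rule hom_qgrad[OF \<iota>_hom is_ring Q nonzero_vecs_D[OF w]])
    then have "qgrad K (qbase_change F Q) (map_vec \<iota> w) = (\<zero>\<^bsub>K\<^esub>, \<zero>\<^bsub>K\<^esub>, \<zero>\<^bsub>K\<^esub>)"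
      by (simp add: g \<iota>_zero)
    then show False using K map_\<iota>_nonzero[OF w] by (auto simp: nonsingular_def)
  qed
qed

lemma finite_nonzero_vecs: "finite (nonzero_vecs F)"
  using finite_carrier by (simp add: nonzero_vecs_def)

lemma qgrad_nonzero:
  assumes "Q \<in> qforms F" "nonsingular F Q" "w \<in> nonzero_vecs F"
  shows "qgrad F Q w \<in> nonzero_vecs F"
  using assms form_closed(2)[OF assms(1) nonzero_vecs_D[OF assms(3)]]
  unfolding nonsingular_def nonzero_vecs_def by auto

text \<open>An injective self-map of a finite set is onto.\<close>

lemma qgrad_surj:
  assumes "Q \<in> qforms F" "nonsingular F Q" "l \<in> nonzero_vecs F"
  obtains w where "w \<in> nonzero_vecs F" "qgrad F Q w = l"
proof -
  have "inj_on (qgrad F Q) (nonzero_vecs F)"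
    by (rule inj_on_subset[OF inj_on_qgrad[OF assms(1,2)]]) (auto dest: nonzero_vecs_D)
  then have "qgrad F Q ` nonzero_vecs F = nonzero_vecs F"
    using endo_inj_surj[OF finite_nonzero_vecs] qgrad_nonzero[OF assms(1,2)] by blast
  with assms(3) have "l \<in> qgrad F Q ` nonzero_vecs F" by simp
  then show ?thesis by (rule imageE) (rule that, simp_all)
qed

text \<open>The gradient map is onto over F, so \<open>l\<close> is the gradient at some
  \<open>w\<close> over F. Injectivity over the closure identifies \<open>w\<close> with a multiple
  of the geometric contact point, which is therefore rational, and \<open>w\<close> lies on the
  conic.\<close>

lemma is_tangent_vec_iff:
  assumes Q: "Q \<in> qforms F" and irr: "geom_irreducible F Q" and l: "l \<in> nonzero_vecs F"
  shows "is_tangent_vec K (qbase_change F Q) (map_vec \<iota> l)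
    \<longleftrightarrow> (\<exists>w\<in>nonzero_vecs F. qeval F Q w = \<zero> \<and> qgrad F Q w = l)"
proof -
  let ?Q = "qbase_change F Q"
  interpret K: plane K by (simp add: plane_def K_field)
  note ns = geom_irreducible_nonsingular[OF Q irr]
  note QK = base_change_closed[OF Q]
  have ev: "qeval K ?Q (map_vec \<iota> w) = \<iota> (qeval F Q w)" "qgrad K ?Q (map_vec \<iota> w) = map_vec \<iota> (qgrad F Q w)"
    if "w \<in> nonzero_vecs F" for w
    unfolding qbase_change_def
    by (rule hom_qeval[OF \<iota>_hom is_ring Q nonzero_vecs_D[OF that]],
        rule hom_qgrad[OF \<iota>_hom is_ring Q nonzero_vecs_D[OF that]])
  show ?thesis
  proof
    assume "\<exists>w\<in>nonzero_vecs F. qeval F Q w = \<zero> \<and> qgrad F Q w = l"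
    then obtain w where w: "w \<in> nonzero_vecs F" "qeval F Q w = \<zero>" "qgrad F Q w = l" by blast
    have lK: "map_vec \<iota> l \<in> nonzero_vecs K" by (rule map_\<iota>_nonzero[OF l])
    then have "(map_vec \<iota> l, map_vec \<iota> l) \<in> proj_rel K"
      using K.equiv_proj_rel by (auto simp: equiv_def refl_on_def)
    then show "is_tangent_vec K ?Q (map_vec \<iota> l)"
      unfolding is_tangent_vec_def
      using map_\<iota>_nonzero[OF w(1)] ev[OF w(1)] w by (intro bexI[of _ "map_vec \<iota> w"]) (auto simp: \<iota>_zero)
  next
    assume "is_tangent_vec K ?Q (map_vec \<iota> l)"
    then obtain v where v: "v \<in> nonzero_vecs K" "qeval K ?Q v = \<zero>\<^bsub>K\<^esub>"
      and "(qgrad K ?Q v, map_vec \<iota> l) \<in> proj_rel K" by (auto simp: is_tangent_vec_def)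
    then obtain k where k: "k \<in> carrier K" "k \<noteq> \<zero>\<^bsub>K\<^esub>" "map_vec \<iota> l = K.scale k (qgrad K ?Q v)"
      by (auto simp: K.proj_rel_iff)
    obtain w where w: "w \<in> nonzero_vecs F" "qgrad F Q w = l" using qgrad_surj[OF Q ns(2) l] .
    have vv: "v \<in> vecs K" by (rule K.nonzero_vecs_D[OF v(1)])
    have "qgrad K ?Q (map_vec \<iota> w) = qgrad K ?Q (K.scale k v)"
      using ev(2)[OF w(1)] w(2) k K.qgrad_scale[OF QK k(1) vv] by simp
    then have eq: "map_vec \<iota> w = K.scale k v"
      using K.inj_on_qgrad[OF QK ns(1)] K.nonzero_vecs_D[OF map_\<iota>_nonzero[OF w(1)]] K.scale_closed[OF k(1) vv]
      by (metis inj_onD)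
    have "\<iota> (qeval F Q w) = k \<otimes>\<^bsub>K\<^esub> k \<otimes>\<^bsub>K\<^esub> \<zero>\<^bsub>K\<^esub>"
      using ev(1)[OF w(1)] K.qeval_scale[OF QK k(1) vv] eq v(2) by simp
    then have "\<iota> (qeval F Q w) = \<iota> \<zero>" using k(1) by (simp add: \<iota>_zero)
    then show "\<exists>w\<in>nonzero_vecs F. qeval F Q w = \<zero> \<and> qgrad F Q w = l" using w by (auto simp: \<iota>_eq)
  qed
qed

text \<open>The gradient carries contact vectors injectively to coefficient vectors of tangents
  through \<open>p\<close>. The image is closed under scaling, and its classes are these
  tangents.\<close>

lemma card_polar_pts:
  assumes Q: "Q \<in> qforms F" and irr: "geom_irreducible F Q" and P: "P \<in> proj_points F" and p: "p \<in> P"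
  shows "card (polar_pts F Q p) = (order F - 1) * card (tangents_through F Q P)"
proof -
  note ns = geom_irreducible_nonsingular(2)[OF Q irr]
  have P': "P \<in> nonzero_vecs F // proj_rel F" using P by (simp add: proj_points_def)
  have p0: "p \<in> nonzero_vecs F" by (rule class_eq(2)[OF P' p])
  have pv: "p \<in> vecs F" by (rule nonzero_vecs_D[OF p0])
  let ?S = "qgrad F Q ` polar_pts F Q p"
  have S_iff: "l \<in> ?S \<longleftrightarrow> lin_eval F l p = \<zero> \<and> is_tangent_vec K (qbase_change F Q) (map_vec \<iota> l)"
    if "l \<in> nonzero_vecs F" for l
    unfolding is_tangent_vec_iff[OF Q irr that] polar_pts_def by auto
  have scl: "scaling_closed ?S"
    unfolding scaling_closed_def
  proof (intro conjI ballI)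
    show "?S \<subseteq> nonzero_vecs F"
      using qgrad_nonzero[OF Q ns] by (auto simp: polar_pts_def)
    fix l k assume "l \<in> ?S" and k: "k \<in> carrier F - {\<zero>}"
    then obtain w where w: "w \<in> nonzero_vecs F" "qeval F Q w = \<zero>" "lin_eval F (qgrad F Q w) p = \<zero>"
      and l: "l = qgrad F Q w" by (auto simp: polar_pts_def)
    have wv: "w \<in> vecs F" by (rule nonzero_vecs_D[OF w(1)])
    have "scale k w \<in> polar_pts F Q p"
      using k w wv form_closed[OF Q wv] pv
      by (simp add: polar_pts_def qeval_scale[OF Q] qgrad_scale[OF Q] lin_eval_scale)
    moreover have "scale k l = qgrad F Q (scale k w)"
      using k wv by (simp add: l qgrad_scale[OF Q])
    ultimately show "scale k l \<in> ?S" by blast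
  qed
  have "tangents_through F Q P = {L \<in> nonzero_vecs F // proj_rel F. L \<subseteq> ?S}"
  proof -
    have "(on_line F P L \<and> is_tangent F Q L) \<longleftrightarrow> L \<subseteq> ?S" if L: "L \<in> nonzero_vecs F // proj_rel F" for L
    proof -
      obtain l where l: "l \<in> L" using in_quotient_imp_non_empty[OF equiv_proj_rel L] by blast
      have l0: "l \<in> nonzero_vecs F" by (rule class_eq(2)[OF L l])
      have lv: "l \<in> vecs F" by (rule nonzero_vecs_D[OF l0])
      have on: "on_line F P L \<longleftrightarrow> lin_eval F l p = \<zero>"
      proof
        assume "on_line F P L"
        then obtain k k' where k: "k \<in> carrier F - {\<zero>}" "k' \<in> carrier F - {\<zero>}"
          and "lin_eval F (scale k l) (scale k' p) = \<zero>"
          unfolding on_line_def class_eq(1)[OF P' p] class_eq(1)[OF L l] by blast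
        then have "k' \<otimes> (k \<otimes> lin_eval F l p) = \<zero>"
          using lv pv by (simp add: lin_eval_scale)
        then show "lin_eval F l p = \<zero>"
          using k lin_eval_closed[OF lv pv] by (simp add: integral_iff)
      qed (use l p in \<open>auto simp: on_line_def\<close>)
      have tang: "is_tangent F Q L \<longleftrightarrow> is_tangent_vec K (qbase_change F Q) (map_vec \<iota> l)"
      proof
        assume "is_tangent F Q L"
        then obtain l' where l': "l' \<in> L" "is_tangent_vec K (qbase_change F Q) (map_vec \<iota> l')"
          by (auto simp: is_tangent_def)
        have l'0: "l' \<in> nonzero_vecs F" by (rule class_eq(2)[OF L l'(1)])
        obtain w where w: "w \<in> nonzero_vecs F" "qeval F Q w = \<zero>" "qgrad F Q w = l'"
          using l'(2) is_tangent_vec_iff[OF Q irr l'0] by blast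
        obtain k where k: "k \<in> carrier F - {\<zero>}" "l = scale k l'"
          using l class_eq(1)[OF L l'(1)] by blast
        have wv: "w \<in> vecs F" by (rule nonzero_vecs_D[OF w(1)])
        have "scale k w \<in> nonzero_vecs F" "qeval F Q (scale k w) = \<zero>" "qgrad F Q (scale k w) = l"
          using k w wv by (simp_all add: qeval_scale[OF Q] qgrad_scale[OF Q])
        then show "is_tangent_vec K (qbase_change F Q) (map_vec \<iota> l)"
          using is_tangent_vec_iff[OF Q irr l0] by blast
      next
        assume "is_tangent_vec K (qbase_change F Q) (map_vec \<iota> l)"
        then show "is_tangent F Q L"
          unfolding is_tangent_def using l by (intro bexI[of _ l]) (auto simp: case_prod_unfold map_prod_def)
      qed
      show ?thesis
        unfolding on tang class_subset_iff[OF scl L l] using S_iff[OF l0] by blast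
    qed
    then show ?thesis by (auto simp: tangents_through_def proj_lines_def)
  qed
  moreover have "card ?S = card (polar_pts F Q p)"
    by (rule card_image, rule inj_on_subset[OF inj_on_qgrad[OF Q ns]]) (auto simp: polar_pts_def dest: nonzero_vecs_D)
  ultimately show ?thesis using card_scaling_closed[OF finite_carrier scl] by simp
qed

lemma order_ge_2: "order F \<ge> 2"
proof -
  have "card {\<zero>, \<one>} \<le> card (carrier F)"
    by (rule card_mono) (auto simp: finite_carrier)
  then show ?thesis using zero_not_one by (simp add: order_def)
qed

lemma finite_polar_pts: "finite (polar_pts F Q p)"
  using finite_nonzero_vecs by (auto simp: polar_pts_def intro: finite_subset)

lemma on_conic_iff:
  assumes Q: "Q \<in> qforms F" and P: "P \<in> proj_points F" and p: "p \<in> P"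
  shows "on_conic F P Q \<longleftrightarrow> qeval F Q p = \<zero>"
proof
  have P': "P \<in> nonzero_vecs F // proj_rel F" using P by (simp add: proj_points_def)
  have pv: "p \<in> vecs F" by (rule nonzero_vecs_D[OF class_eq(2)[OF P' p]])
  assume "on_conic F P Q"
  then obtain k where "k \<in> carrier F - {\<zero>}" "qeval F Q (scale k p) = \<zero>"
    unfolding on_conic_def class_eq(1)[OF P' p] by blast
  then show "qeval F Q p = \<zero>"
    using form_closed(1)[OF Q pv] by (simp add: qeval_scale[OF Q _ pv] integral_iff)
qed (use p in \<open>auto simp: on_conic_def\<close>)

lemma external_pt_iff:
  assumes Q: "Q \<in> qforms F" and irr: "geom_irreducible F Q" and P: "P \<in> proj_points F" and p: "p \<in> P"
  shows "external_pt F Q P \<longleftrightarrow> qeval F Q p \<noteq> \<zero> \<and> card (polar_pts F Q p) = 2 * (order F - 1)"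
    "internal_pt F Q P \<longleftrightarrow> qeval F Q p \<noteq> \<zero> \<and> polar_pts F Q p = {}"
proof -
  have pos: "order F - 1 > 0" using order_ge_2 by simp
  show "external_pt F Q P \<longleftrightarrow> qeval F Q p \<noteq> \<zero> \<and> card (polar_pts F Q p) = 2 * (order F - 1)"
    using pos by (auto simp: external_pt_def on_conic_iff[OF Q P p] card_polar_pts[OF Q irr P p])
  \<comment> \<open>Needed to read cardinality 0 as emptiness, since infinite sets have
    \<open>card\<close> 0 as well.\<close>
  have "finite (tangents_through F Q P)"
  proof (rule finite_subset)
    show "tangents_through F Q P \<subseteq> nonzero_vecs F // proj_rel F"
      by (auto simp: tangents_through_def proj_lines_def)
    show "finite (nonzero_vecs F // proj_rel F)"
      by (rule finite_quotient[OF finite_nonzero_vecs]) (auto simp: proj_rel_def)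
  qed
  then have "tangents_through F Q P = {} \<longleftrightarrow> polar_pts F Q p = {}"
    using card_polar_pts[OF Q irr P p] pos finite_polar_pts[of Q p]
    by (metis card_eq_0_iff mult_eq_0_iff less_numeral_extra(3))
  then show "internal_pt F Q P \<longleftrightarrow> qeval F Q p \<noteq> \<zero> \<and> polar_pts F Q p = {}"
    by (simp add: internal_pt_def on_conic_iff[OF Q P p])
qed

lemma card_ext_int_vecs:
  assumes C: "C \<in> qforms F" "geom_irreducible F C" and D: "D \<in> qforms F" "geom_irreducible F D"
  shows "card (ext_int_vecs F C D)
    = (order F - 1) * card {P \<in> proj_points F. external_pt F C P \<and> internal_pt F D P}"
proof -
  let ?E = "\<lambda>P. external_pt F C P \<and> internal_pt F D P"
  have mem: "p \<in> ext_int_vecs F C D \<longleftrightarrow> ?E P" if P: "P \<in> nonzero_vecs F // proj_rel F" and p: "p \<in> P" for p P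
    using external_pt_iff[OF C _ p] external_pt_iff[OF D _ p] P class_eq(2)[OF P p]
    by (auto simp: ext_int_vecs_def proj_points_def)
  have sc: "scaling_closed (ext_int_vecs F C D)"
    unfolding scaling_closed_def
  proof (intro conjI ballI)
    show "ext_int_vecs F C D \<subseteq> nonzero_vecs F" by (auto simp: ext_int_vecs_def)
    fix v k assume v: "v \<in> ext_int_vecs F C D" and k: "k \<in> carrier F - {\<zero>}"
    then have v0: "v \<in> nonzero_vecs F" by (auto simp: ext_int_vecs_def)
    let ?P = "proj_rel F `` {v}"
    have P: "?P \<in> nonzero_vecs F // proj_rel F" by (rule quotientI[OF v0])
    have "v \<in> ?P" by (rule equiv_class_self[OF equiv_proj_rel v0])
    moreover have "scale k v \<in> ?P" using v0 k by (auto simp: proj_rel_iff)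
    ultimately show "scale k v \<in> ext_int_vecs F C D" using mem[OF P] v by blast
  qed
  have "P \<subseteq> ext_int_vecs F C D \<longleftrightarrow> ?E P" if P: "P \<in> nonzero_vecs F // proj_rel F" for P
  proof -
    obtain p where p: "p \<in> P" using in_quotient_imp_non_empty[OF equiv_proj_rel P] by blast
    show ?thesis using class_subset_iff[OF sc P p] mem[OF P p] by simp
  qed
  then have "{P \<in> nonzero_vecs F // proj_rel F. P \<subseteq> ext_int_vecs F C D} = {P \<in> proj_points F. ?E P}"
    by (auto simp: proj_points_def)
  then show ?thesis using card_scaling_closed[OF finite_carrier sc] by simp
qed

end

section \<open>Transfer from types to carriers\<close>

definition type_ring :: "'f::field ring" where
  "type_ring = \<lparr>carrier = UNIV, monoid.mult = (*), one = 1, ring.zero = 0, add = (+)\<rparr>"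

lemma type_ring_simps [simp]:
  "carrier type_ring = UNIV" "x \<otimes>\<^bsub>type_ring\<^esub> y = x * y" "\<one>\<^bsub>type_ring\<^esub> = 1"
  "\<zero>\<^bsub>type_ring\<^esub> = 0" "x \<oplus>\<^bsub>type_ring\<^esub> y = x + y"
  by (simp_all add: type_ring_def)

lemma ring_type_ring: "ring (type_ring :: 'f::field ring)"
proof -
  have "\<exists>y. x + y = 0" for x :: 'f
    using add.right_inverse by blast
  then show ?thesis
    unfolding type_ring_def using add.right_inverse
    by unfold_locales (auto simp: algebra_simps Units_def)
qed

lemma type_ring_eval:
  "qeval type_ring Q v = qval Q v"
  "qgrad type_ring Q v = qpolar Q v"
  "lin_eval type_ring v w = dot v w"
  by (cases Q; cases v; cases w; simp)+

lemma qhess_scale: "qhess (map_qform ((*) k) Q) = k * k * k * qhess Q"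
  by (cases Q) (simp add: algebra_simps)

lemma qval_scale: "qval (map_qform ((*) k) Q) v = k * qval Q v"
  by (cases Q; cases v) (simp add: algebra_simps)

lemma card_polar_zeros_iff:
  fixes Q :: "'f::odd_finite_field qform"
  assumes "qhess Q \<noteq> 0" "qval Q v \<noteq> 0"
  shows "card (polar_zeros Q v) = 2 * (CARD('f) - 1) \<longleftrightarrow> qchar (- 2 * qhess Q * qval Q v) = 1"
    "polar_zeros Q v = {} \<longleftrightarrow> qchar (- 2 * qhess Q * qval Q v) = -1"
proof -
  let ?c = "qchar (- 2 * qhess Q * qval Q v)"
  have "card {0, 1 :: 'f} \<le> CARD('f)" by (rule card_mono) auto
  then have q: "CARD('f) \<ge> 2" by simp
  have eq: "int (card (polar_zeros Q v)) = (int CARD('f) - 1) * (1 + ?c)"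
    by (rule card_polar_zeros[OF assms])
  have c: "?c = 1 \<or> ?c = -1" using assms by (auto simp: qchar_def)
  have "card (polar_zeros Q v) = 2 * (CARD('f) - 1) \<longleftrightarrow> int (card (polar_zeros Q v)) = 2 * (int CARD('f) - 1)"
  proof -
    have "2 * (int CARD('f) - 1) = int (2 * (CARD('f) - 1))" using q by (simp add: of_nat_diff)
    then show ?thesis by (simp only: of_nat_eq_iff)
  qed
  also have "\<dots> \<longleftrightarrow> ?c = 1" using c q unfolding eq by auto
  finally show "card (polar_zeros Q v) = 2 * (CARD('f) - 1) \<longleftrightarrow> ?c = 1" .
  have "polar_zeros Q v = {} \<longleftrightarrow> int (card (polar_zeros Q v)) = 0"
    by simp
  also have "\<dots> \<longleftrightarrow> ?c = -1" using c q unfolding eq by auto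
  finally show "polar_zeros Q v = {} \<longleftrightarrow> ?c = -1" .
qed

lemma eq_image_if_iff:
  assumes surj: "\<And>u. \<exists>v\<in>A. f v = u" and sub: "S \<subseteq> A" and iff: "\<And>v. v \<in> A \<Longrightarrow> f v \<in> T \<longleftrightarrow> v \<in> S"
  shows "T = f ` S"
proof
  show "f ` S \<subseteq> T" using sub iff by blast
  show "T \<subseteq> f ` S"
  proof
    fix u assume "u \<in> T"
    moreover obtain v where "v \<in> A" "f v = u" using surj by blast
    ultimately show "u \<in> f ` S" using iff by blast
  qed
qed

text \<open>The bound for vectors, with \<open>nonsingular\<close> in place of geometric
  irreducibility: no closure occurs, so it can be checked through an isomorphism of the ring
  alone.\<close>

definition ext_int_bound :: "'a ring \<Rightarrow> bool" where
  "ext_int_bound R \<longleftrightarrow> (\<forall>C \<in> qforms R. \<forall>D \<in> qforms R.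
     nonsingular R C \<and> nonsingular R D \<and> \<not> proportional R C D \<longrightarrow>
     \<bar>4 * int (card (ext_int_vecs R C D)) - int (order R) ^ 3\<bar> \<le> 33 * int (order R) ^ 2)"

lemma ext_int_bound_class:
  fixes R :: "'a ring" (structure) and h :: "'a \<Rightarrow> 'f::odd_finite_field"
  assumes R: "ring R" and h: "h \<in> ring_hom R type_ring" and bij: "bij_betw h (carrier R) UNIV"
  shows "ext_int_bound R"
  unfolding ext_int_bound_def
proof (intro ballI impI, elim conjE)
  fix C D assume C: "C \<in> qforms R" and D: "D \<in> qforms R" and nsC: "nonsingular R C" and nsD: "nonsingular R D"
    and np: "\<not> proportional R C D"
  interpret ring R by fact
  have inj: "inj_on h (carrier R)" and surj: "h ` carrier R = UNIV" using bij by (auto simp: bij_betw_def)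
  have h0: "h \<zero> = 0" using ring_hom_zero[OF h R ring_type_ring] by simp
  have h_eq0: "h x = 0 \<longleftrightarrow> x = \<zero>" if "x \<in> carrier R" for x
    using inj_onD[OF inj, of x \<zero>] h0 that by auto
  have order: "order R = CARD('f)" using bij by (simp add: order_def bij_betw_same_card)
  let ?h = "map_vec h"
  have bijv: "bij_betw ?h (vecs R) UNIV"
  proof -
    have "bij_betw ?h (vecs R) (UNIV \<times> UNIV \<times> UNIV)" by (intro bij_betw_map_prod bij)
    then show ?thesis by simp
  qed
  have injv: "inj_on ?h (vecs R)" using bijv by (simp add: bij_betw_def)
  have surjv: "\<exists>v\<in>vecs R. ?h v = u" for u
  proof -
    have "u \<in> ?h ` vecs R" using bijv by (simp only: bij_betw_def UNIV_I)
    then show ?thesis by (rule imageE) (rule bexI, rule sym)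
  qed
  have nz: "?h v \<noteq> (0, 0, 0) \<longleftrightarrow> v \<in> nonzero_vecs R" if "v \<in> vecs R" for v
    using that by (auto simp: nonzero_vecs_def h_eq0)
  have nzD: "v \<in> vecs R" if "v \<in> nonzero_vecs R" for v using that by (simp add: nonzero_vecs_def)
  have ev: "qval (map_qform h Q) (?h v) = h (qeval R Q v)" "qpolar (map_qform h Q) (?h v) = ?h (qgrad R Q v)"
    if "Q \<in> qforms R" "v \<in> vecs R" for Q v
    using hom_qeval[OF h R that] hom_qgrad[OF h R that] by (simp_all add: type_ring_eval)
  have dot: "dot (?h l) (?h v) = h (lin_eval R l v)" if "l \<in> vecs R" "v \<in> vecs R" for l v
    using that by (cases l; cases v) (auto simp: ring_hom_memE(2,3)[OF h])
  have cl: "qeval R Q v \<in> carrier R" "qgrad R Q v \<in> vecs R" if "Q \<in> qforms R" "v \<in> vecs R" for Q v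
    using that by (cases Q; cases v; auto simp: qforms_def)+
  have lcl: "lin_eval R l v \<in> carrier R" if "l \<in> vecs R" "v \<in> vecs R" for l v
    using that by (cases l; cases v) auto
  have hess: "qhess (map_qform h Q) \<noteq> 0" if Q: "Q \<in> qforms R" and ns: "nonsingular R Q" for Q
  proof (rule qhess_neq_0)
    fix w :: "'f \<times> 'f \<times> 'f" assume w: "w \<noteq> (0, 0, 0)"
    obtain v where v: "v \<in> vecs R" "?h v = w" using surjv by blast
    then have "v \<in> nonzero_vecs R" using nz w by blast
    then have "qgrad R Q v \<in> nonzero_vecs R"
      using ns cl(2)[OF Q v(1)] by (auto simp: nonsingular_def nonzero_vecs_def)
    then show "qpolar (map_qform h Q) w \<noteq> (0, 0, 0)"
      using ev(2)[OF Q v(1)] v(2) nz[OF cl(2)[OF Q v(1)]] by simp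
  qed
  have polar: "polar_zeros (map_qform h Q) (?h v) = ?h ` polar_pts R Q v" if Q: "Q \<in> qforms R" and v: "v \<in> vecs R" for Q v
  proof -
    have iff: "?h w \<in> polar_zeros (map_qform h Q) (?h v) \<longleftrightarrow> w \<in> polar_pts R Q v" if w: "w \<in> vecs R" for w
    proof -
      \<comment> \<open>Reciprocity exchanges the polar line of \<open>v\<close> for the tangent at
        \<open>w\<close>.\<close>
      have "dot (qpolar (map_qform h Q) (?h v)) (?h w) = h (lin_eval R (qgrad R Q w) v)"
        unfolding dot_qpolar_commute[of _ "?h v"] by (simp add: ev[OF Q w] dot cl[OF Q w] v)
      then show ?thesis
        using nz[OF w] nzD[of w] h_eq0[OF cl(1)[OF Q w]] h_eq0[OF lcl[OF cl(2)[OF Q w] v]]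
        unfolding polar_zeros_def polar_pts_def by (simp add: ev[OF Q w])
    qed
    have sub: "polar_pts R Q v \<subseteq> vecs R" by (auto simp: polar_pts_def dest: nzD)
    show ?thesis by (rule eq_image_if_iff[OF surjv sub iff])
  qed
  have card_polar: "card (polar_zeros (map_qform h Q) (?h v)) = card (polar_pts R Q v)"
    if Q: "Q \<in> qforms R" and v: "v \<in> vecs R" for Q v
    unfolding polar[OF that]
    by (rule card_image, rule inj_on_subset[OF injv]) (auto simp: polar_pts_def dest: nzD)
  \<comment> \<open>After scaling by this factor, the character of the value itself is 1 at external
    and -1 at internal points, which is the shape that \<open>abs_card_qchar_le\<close>
    counts.\<close>
  define k where "k Q = - 2 * qhess (map_qform h Q)" for Q
  define Q' where "Q' Q = map_qform ((*) (k Q)) (map_qform h Q)" for Q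
  have k0: "k Q \<noteq> 0" if "Q \<in> qforms R" "nonsingular R Q" for Q using hess[OF that] by (simp add: k_def)
  have hess': "qhess (Q' Q) \<noteq> 0" if "Q \<in> qforms R" "nonsingular R Q" for Q
    unfolding Q'_def qhess_scale using hess[OF that] k0[OF that] by simp
  have type: "qval (map_qform h Q) (?h v) \<noteq> 0 \<and> card (polar_pts R Q v) = 2 * (order R - 1) \<longleftrightarrow> qchar (qval (Q' Q) (?h v)) = 1"
    "qval (map_qform h Q) (?h v) \<noteq> 0 \<and> polar_pts R Q v = {} \<longleftrightarrow> qchar (qval (Q' Q) (?h v)) = -1"
    if "Q \<in> qforms R" "nonsingular R Q" "v \<in> vecs R" for Q v
  proof -
    have val: "qval (Q' Q) (?h v) = - 2 * qhess (map_qform h Q) * qval (map_qform h Q) (?h v)"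
      by (simp add: Q'_def qval_scale k_def)
    show "qval (map_qform h Q) (?h v) \<noteq> 0 \<and> card (polar_pts R Q v) = 2 * (order R - 1) \<longleftrightarrow> qchar (qval (Q' Q) (?h v)) = 1"
      using card_polar_zeros_iff(1)[OF hess[OF that(1,2)], of "?h v"] card_polar[OF that(1,3)]
      by (cases "qval (map_qform h Q) (?h v) = 0") (simp_all add: val order)
    show "qval (map_qform h Q) (?h v) \<noteq> 0 \<and> polar_pts R Q v = {} \<longleftrightarrow> qchar (qval (Q' Q) (?h v)) = -1"
      using card_polar_zeros_iff(2)[OF hess[OF that(1,2)], of "?h v"] polar[OF that(1,3)]
      by (cases "qval (map_qform h Q) (?h v) = 0") (simp_all add: val)
  qed
  let ?T = "{u. qchar (qval (Q' C) u) = 1 \<and> qchar (qval (Q' D) u) = -1}"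
  have iff: "?h v \<in> ?T \<longleftrightarrow> v \<in> ext_int_vecs R C D" if v: "v \<in> vecs R" for v
  proof -
    have "qval (map_qform h C) (?h v) \<noteq> 0 \<longleftrightarrow> qeval R C v \<noteq> \<zero>"
      "qval (map_qform h D) (?h v) \<noteq> 0 \<longleftrightarrow> qeval R D v \<noteq> \<zero>"
      by (simp_all add: ev[OF C v] ev[OF D v] h_eq0 cl(1)[OF C v] cl(1)[OF D v])
    moreover have "v \<in> nonzero_vecs R" if "qeval R C v \<noteq> \<zero>"
    proof (rule ccontr)
      assume "v \<notin> nonzero_vecs R"
      then have "v = (\<zero>, \<zero>, \<zero>)" using v by (auto simp: nonzero_vecs_def)
      then show False using that C by (cases C) (auto simp: qforms_def)
    qed
    ultimately show ?thesis
      using type(1)[OF C nsC v] type(2)[OF D nsD v] by (auto simp: ext_int_vecs_def)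
  qed
  have sub: "ext_int_vecs R C D \<subseteq> vecs R" by (auto simp: ext_int_vecs_def dest: nzD)
  have "?T = ?h ` ext_int_vecs R C D" by (rule eq_image_if_iff[OF surjv sub iff])
  then have card: "card ?T = card (ext_int_vecs R C D)"
    by (simp only: card_image[OF inj_on_subset[OF injv sub]])
  have "Q' C \<noteq> map_qform ((*) t) (Q' D)" for t
  proof
    assume eq: "Q' C = map_qform ((*) t) (Q' D)"
    then have t0: "t \<noteq> 0" using hess'[OF C nsC] by (cases "Q' D") auto
    \<comment> \<open>Solving k(C) C = t k(D) D for D gives D = s C, and the preimage of
      \<open>s\<close> in the ring witnesses proportionality.\<close>
    define s where "s = k C / (t * k D)"
    have s0: "s \<noteq> 0" using k0[OF C nsC] k0[OF D nsD] t0 by (simp add: s_def)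
    obtain r where r: "r \<in> carrier R" "h r = s" using surj by (metis UNIV_I imageE)
    have r0: "r \<noteq> \<zero>" using r s0 h0 by auto
    have "map_qform h D = map_qform ((*) s) (map_qform h C)"
      using eq k0[OF C nsC] k0[OF D nsD] t0
      by (cases C; cases D) (auto simp: Q'_def s_def field_simps)
    also have "\<dots> = map_qform h (map_qform (\<lambda>a. r \<otimes> a) C)"
      unfolding qform.map_comp
      by (rule qform.map_cong0) (use C r in \<open>auto simp: qforms_def ring_hom_memE(2)[OF h]\<close>)
    finally have "D = map_qform (\<lambda>a. r \<otimes> a) C"
      using C D r inj by (cases C; cases D) (auto simp: qforms_def inj_on_def)
    then show False using np r r0 unfolding proportional_def by blast
  qed
  then have "\<bar>4 * int (card ?T) - int CARD('f) ^ 3\<bar> \<le> 33 * int CARD('f) ^ 2"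
    by (rule abs_card_qchar_le[OF hess'[OF C nsC] hess'[OF D nsD]])
  then show "\<bar>4 * int (card (ext_int_vecs R C D)) - int (order R) ^ 3\<bar> \<le> 33 * int (order R) ^ 2"
    by (simp add: card order)
qed

text \<open>The counting argument is carried out for types of class \<open>odd_finite_field\<close>, while the theorem
  quantifies over carriers. There is no type for an arbitrary carrier, but a single type suffices: its
  carrier is a copy inside \<open>int\<close> of a field that violates the bound, if there is such a field
  in \<open>'a ring\<close>, and the field with three elements otherwise. The class of this type then refutes the
  violation.\<close>

definition odd_finite_ring :: "'a ring \<Rightarrow> bool" where
  "odd_finite_ring R \<longleftrightarrow> field R \<and> finite (carrier R) \<and> odd (order R)"

definition witness_ring :: "'a itself \<Rightarrow> int ring" where
  "witness_ring _ = (SOME R. odd_finite_ring R \<and>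
     ((\<exists>F :: 'a ring. odd_finite_ring F \<and> \<not> ext_int_bound F) \<longrightarrow>
      (\<exists>F :: 'a ring. odd_finite_ring F \<and> \<not> ext_int_bound F \<and> ring_iso F R \<noteq> {})))"

lemma odd_finite_residue_ring_3: "odd_finite_ring (residue_ring 3)"
proof -
  interpret residues_prime 3 "residue_ring 3" by unfold_locales simp_all
  show ?thesis
    using is_field by (simp add: odd_finite_ring_def order_def res_carrier_eq)
qed

text \<open>A finite carrier injects into the natural numbers, and the ring structure is carried
  along the injection. The target is \<open>int\<close> because the default field
  \<open>residue_ring 3\<close> lives there.\<close>

lemma odd_finite_ring_int_copy:
  assumes "odd_finite_ring (F :: 'a ring)"
  obtains R :: "int ring" where "odd_finite_ring R" "ring_iso F R \<noteq> {}"
proof -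
  interpret field F using assms by (simp add: odd_finite_ring_def)
  have fin: "finite (carrier F)" using assms by (simp add: odd_finite_ring_def)
  obtain f :: "'a \<Rightarrow> nat" where "inj_on f (carrier F)" using finite_imp_inj_to_nat_seg[OF fin] by blast
  then have f: "inj_on (\<lambda>x. int (f x)) (carrier F)" by (auto simp: inj_on_def)
  let ?R = "image_ring (\<lambda>x. int (f x)) F"
  have "odd_finite_ring ?R"
    using inj_imp_image_ring_is_field[OF f] fin assms card_image[OF f]
    by (simp add: odd_finite_ring_def order_def image_ring_carrier)
  moreover have "ring_iso F ?R \<noteq> {}" using inj_imp_image_ring_iso[OF f] by blast
  ultimately show ?thesis by (rule that)
qed

text \<open>The implication in the choice keeps it satisfiable whether or not a violating field
  exists, so the chosen ring is an odd finite field unconditionally, as the type definition and its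
  class instance demand.\<close>

lemma witness_ring:
  shows odd_finite_witness_ring: "odd_finite_ring (witness_ring TYPE('a))"
    and witness_ring_counterexample:
      "odd_finite_ring (F :: 'a ring) \<Longrightarrow> \<not> ext_int_bound F \<Longrightarrow>
        \<exists>F :: 'a ring. odd_finite_ring F \<and> \<not> ext_int_bound F \<and> ring_iso F (witness_ring TYPE('a)) \<noteq> {}"
proof -
  have "\<exists>R :: int ring. odd_finite_ring R \<and>
     ((\<exists>F :: 'a ring. odd_finite_ring F \<and> \<not> ext_int_bound F) \<longrightarrow>
      (\<exists>F :: 'a ring. odd_finite_ring F \<and> \<not> ext_int_bound F \<and> ring_iso F R \<noteq> {}))"
    using odd_finite_ring_int_copy odd_finite_residue_ring_3 by metis
  then have *: "odd_finite_ring (witness_ring TYPE('a)) \<and>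
     ((\<exists>F :: 'a ring. odd_finite_ring F \<and> \<not> ext_int_bound F) \<longrightarrow>
      (\<exists>F :: 'a ring. odd_finite_ring F \<and> \<not> ext_int_bound F \<and> ring_iso F (witness_ring TYPE('a)) \<noteq> {}))"
    unfolding witness_ring_def by (rule someI_ex)
  show "odd_finite_ring (witness_ring TYPE('a))" using * by blast
  show "odd_finite_ring (F :: 'a ring) \<Longrightarrow> \<not> ext_int_bound F \<Longrightarrow>
        \<exists>F :: 'a ring. odd_finite_ring F \<and> \<not> ext_int_bound F \<and> ring_iso F (witness_ring TYPE('a)) \<noteq> {}"
    using * by blast
qed

typedef 'a witness = "carrier (witness_ring TYPE('a))"
proof -
  interpret field "witness_ring TYPE('a)" using odd_finite_witness_ring[where 'a = 'a] by (simp add: odd_finite_ring_def)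
  show ?thesis using zero_closed by blast
qed

instantiation witness :: (type) odd_finite_field
begin

definition "0 = Abs_witness \<zero>\<^bsub>witness_ring TYPE('a)\<^esub>"
definition "1 = Abs_witness \<one>\<^bsub>witness_ring TYPE('a)\<^esub>"
definition "x + y = Abs_witness (Rep_witness x \<oplus>\<^bsub>witness_ring TYPE('a)\<^esub> Rep_witness (y :: 'a witness))"
definition "x * y = Abs_witness (Rep_witness x \<otimes>\<^bsub>witness_ring TYPE('a)\<^esub> Rep_witness (y :: 'a witness))"
definition "- x = Abs_witness (\<ominus>\<^bsub>witness_ring TYPE('a)\<^esub> Rep_witness (x :: 'a witness))"
definition "x - (y :: 'a witness) = x + - y"
definition "inverse x = (if x = 0 then 0 else Abs_witness (inv\<^bsub>witness_ring TYPE('a)\<^esub> Rep_witness (x :: 'a witness)))"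
definition "x div (y :: 'a witness) = x * inverse y"

instance
proof -
  interpret W: field "witness_ring TYPE('a)" using odd_finite_witness_ring[where 'a = 'a] by (simp add: odd_finite_ring_def)
  note [simp] = Rep_witness Abs_witness_inverse Rep_witness_inverse
  note defs = zero_witness_def one_witness_def plus_witness_def times_witness_def uminus_witness_def
  have eq: "x = y \<longleftrightarrow> Rep_witness x = Rep_witness y" for x y :: "'a witness" by (simp add: Rep_witness_inject)
  have inv: "inv\<^bsub>witness_ring TYPE('a)\<^esub> a \<in> carrier (witness_ring TYPE('a))"
    "inv\<^bsub>witness_ring TYPE('a)\<^esub> a \<otimes>\<^bsub>witness_ring TYPE('a)\<^esub> a = \<one>\<^bsub>witness_ring TYPE('a)\<^esub>"
    if "a \<in> carrier (witness_ring TYPE('a))" "a \<noteq> \<zero>\<^bsub>witness_ring TYPE('a)\<^esub>" for a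
    using that by (simp_all add: W.field_Units)
  show "OFCLASS('a witness, odd_finite_field_class)"
  proof
    fix a b c :: "'a witness"
    show "a + b + c = a + (b + c)" by (simp add: eq defs W.a_assoc)
    show "a + b = b + a" by (simp add: eq defs W.a_comm)
    show "0 + a = a" by (simp add: eq defs)
    show "- a + a = 0" by (simp add: eq defs W.l_neg)
    show "a - b = a + - b" by (simp add: minus_witness_def)
    show "a * b * c = a * (b * c)" by (simp add: eq defs W.m_assoc)
    show "a * b = b * a" by (simp add: eq defs W.m_comm)
    show "1 * a = a" by (simp add: eq defs)
    show "(a + b) * c = a * c + b * c" by (simp add: eq defs W.l_distr)
    show "(0 :: 'a witness) \<noteq> 1" by (simp add: eq defs)
    show "inverse a * a = 1" if "a \<noteq> 0"
    proof -
      have "Rep_witness a \<noteq> \<zero>\<^bsub>witness_ring TYPE('a)\<^esub>" using that by (simp add: eq defs)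
      then show ?thesis using that by (simp add: inverse_witness_def eq times_witness_def one_witness_def inv)
    qed
    show "a div b = a * inverse b" by (simp add: divide_witness_def)
    show "inverse (0 :: 'a witness) = 0" by (simp add: inverse_witness_def)
    have "finite (carrier (witness_ring TYPE('a)))"
      using odd_finite_witness_ring[where 'a = 'a] by (simp add: odd_finite_ring_def)
    then show "finite (UNIV :: 'a witness set)"
      by (metis finite_imageI type_definition.Abs_image type_definition_witness)
    show "(1 :: 'a witness) + 1 \<noteq> 0"
      using W.one_plus_one_neq_zero odd_finite_witness_ring[where 'a = 'a]
      by (simp add: eq defs odd_finite_ring_def)
  qed
qed

end

text \<open>The type \<open>'a witness\<close> cannot depend on the field \<open>F\<close>, so the
  contradiction is drawn for a violating field \<open>G\<close> isomorphic to the chosen ring, which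
  may differ from \<open>F\<close>.\<close>

lemma ext_int_bound:
  assumes "odd_finite_ring (F :: 'a ring)"
  shows "ext_int_bound F"
proof (rule ccontr)
  assume "\<not> ext_int_bound F"
  then obtain G :: "'a ring" where G: "odd_finite_ring G" "\<not> ext_int_bound G"
    and "ring_iso G (witness_ring TYPE('a)) \<noteq> {}"
    using witness_ring_counterexample[OF assms] by blast
  then obtain g where g: "g \<in> ring_hom G (witness_ring TYPE('a))" "bij_betw g (carrier G) (carrier (witness_ring TYPE('a)))"
    unfolding ring_iso_def by blast
  have A: "Abs_witness \<in> ring_hom (witness_ring TYPE('a)) (type_ring :: 'a witness ring)"
    by (rule ring_hom_memI) (simp_all add: plus_witness_def times_witness_def one_witness_def Abs_witness_inverse)
  have bij: "bij_betw Abs_witness (carrier (witness_ring TYPE('a))) (UNIV :: 'a witness set)"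
    by (rule bij_betw_byWitness[where f' = Rep_witness])
       (auto simp: Abs_witness_inverse Rep_witness_inverse Rep_witness)
  have "ring G" using G(1) by (simp add: odd_finite_ring_def field_def domain_def cring_def)
  moreover have "Abs_witness \<circ> g \<in> ring_hom G (type_ring :: 'a witness ring)"
    by (rule ring_hom_trans[OF g(1) A])
  moreover have "bij_betw (Abs_witness \<circ> g :: 'a \<Rightarrow> 'a witness) (carrier G) UNIV"
    by (rule bij_betw_trans[OF g(2) bij])
  ultimately have "ext_int_bound G" by (rule ext_int_bound_class)
  with G show False by simp
qed

theorem theorem1p2:
  shows "\<exists>K::real. \<forall>(F :: 'a ring) C D.
    field F \<and> finite (carrier F) \<and> odd (order F) \<and>
    C \<in> qforms F \<and> geom_irreducible F C \<and>
    D \<in> qforms F \<and> geom_irreducible F D \<and>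
    \<not> proportional F C D \<longrightarrow>
    \<bar>real (card {P \<in> proj_points F. external_pt F C P \<and> internal_pt F D P}) - real (order F) ^ 2 / 4\<bar>
      \<le> K * real (order F) powr (3 / 2)"
proof (intro exI[of _ 17] allI impI, elim conjE)
  fix F :: "'a ring" and C D
  assume F: "field F" "finite (carrier F)" "odd (order F)"
    and C: "C \<in> qforms F" "geom_irreducible F C" and D: "D \<in> qforms F" "geom_irreducible F D"
    and np: "\<not> proportional F C D"
  interpret odd_plane F
    using F by (simp add: odd_plane_def odd_plane_axioms_def plane_def)
  define n where "n = real (card {P \<in> proj_points F. external_pt F C P \<and> internal_pt F D P})"
  define q where "q = real (order F)"
  have q: "q \<ge> 2" using order_ge_2 by (simp add: q_def)
  have card: "real (card (ext_int_vecs F C D)) = (q - 1) * n"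
    using card_ext_int_vecs[OF C D] order_ge_2 by (simp add: n_def q_def of_nat_diff)
  have "\<bar>4 * int (card (ext_int_vecs F C D)) - int (order F) ^ 3\<bar> \<le> 33 * int (order F) ^ 2"
    using ext_int_bound[of F] F C D np geom_irreducible_nonsingular(2)[OF C] geom_irreducible_nonsingular(2)[OF D]
    unfolding ext_int_bound_def odd_finite_ring_def by blast
  then have "real_of_int \<bar>4 * int (card (ext_int_vecs F C D)) - int (order F) ^ 3\<bar> \<le> real_of_int (33 * int (order F) ^ 2)"
    by (simp only: of_int_le_iff)
  then have bound: "\<bar>4 * ((q - 1) * n) - q ^ 3\<bar> \<le> 33 * q ^ 2"
    using card by (simp add: q_def)
  \<comment> \<open>Replacing q^3 by (q - 1) q^2 raises 33 to 34; dividing by q - 1 \<ge> q / 2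
    gives 68 q, and dividing by 4 gives the constant 17.\<close>
  have "(q - 1) * (4 * n - q ^ 2) = (4 * ((q - 1) * n) - q ^ 3) + q ^ 2"
    by (simp add: algebra_simps power2_eq_square power3_eq_cube)
  then have "\<bar>(q - 1) * (4 * n - q ^ 2)\<bar> \<le> 34 * q ^ 2"
    using bound by (smt (verit) zero_le_power2)
  then have "(q - 1) * \<bar>4 * n - q ^ 2\<bar> \<le> 34 * q ^ 2"
    using q by (simp add: abs_mult)
  also have "34 * q ^ 2 \<le> (q - 1) * (68 * q)"
    using q mult_right_mono[of 2 q q] by (simp add: algebra_simps power2_eq_square)
  finally have "\<bar>4 * n - q ^ 2\<bar> \<le> 68 * q"
    using q by (simp add: mult_le_cancel_left)
  then have "\<bar>n - q ^ 2 / 4\<bar> \<le> 17 * q" by (simp add: abs_le_iff)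
  \<comment> \<open>The error obtained is linear in q; it is weakened here to the exponent of the
    statement.\<close>
  also have "q \<le> q powr (3 / 2)"
    using q powr_mono[of 1 "3 / 2" q] by simp
  finally show "\<bar>real (card {P \<in> proj_points F. external_pt F C P \<and> internal_pt F D P}) - real (order F) ^ 2 / 4\<bar>
      \<le> 17 * real (order F) powr (3 / 2)"
    by (simp add: n_def q_def)
qed

end
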